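(* Let $0<\varepsilon\le 1$ be fixed. The randomized two-party communication complexity of the following task is $\Omega(n^2)$: given a marriage market $(W,M,\succ_W,\succ_M)$ with full preference lists and $|W|=|M|=n$, where Alice holds $\succ_W$ and Bob holds $\succ_M$, output $\varepsilon n$ pairs $(w,m)\in W\times M$ each of which is contained in some stable marriage (respectively, in every stable marriage).
   Context: A marriage market with full preference lists: disjoint sets $W$, $M$ of size $n$, each woman has a total order on $M$ (profile $\succ_W$) and each man a total order on $W$ (profile $\succ_M$). A perfect marriage is a bijection between $W$ and $M$, identified with its set of pairs. A pair $(w,m)$ is blocking for $\mu$ if $w$ prefers $m$ to her spouse in $\mu$ and $m$ prefers $w$ to his spouse in $\mu$; $\mu$ is stable if it has no blocking pair. In two-party communication complexity, the cost of a protocol is the number of bits exchanged in the worst case; a randomized protocol must produce a correct output with probability at least $2/3$ on every input; the complexity is the least cost of such a protocol. The bound is asymptotic in $n$. *)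

theory Defs
  imports "HOL-Probability.Probability_Mass_Function"
begin

datatype ('a, 'b, 'o) prot =
    Out 'o
  | AliceSends "'a \<Rightarrow> bool" "('a, 'b, 'o) prot" "('a, 'b, 'o) prot"
  | BobSends "'b \<Rightarrow> bool" "('a, 'b, 'o) prot" "('a, 'b, 'o) prot"

fun run :: "('a, 'b, 'o) prot \<Rightarrow> 'a \<Rightarrow> 'b \<Rightarrow> 'o" where
  "run (Out v) x y = v"
| "run (AliceSends f l r) x y = (if f x then run l x y else run r x y)"
| "run (BobSends g l r) x y = (if g y then run l x y else run r x y)"

fun comm :: "('a, 'b, 'o) prot \<Rightarrow> 'a \<Rightarrow> 'b \<Rightarrow> nat" where
  "comm (Out v) x y = 0"
| "comm (AliceSends f l r) x y = Suc (if f x then comm l x y else comm r x y)"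
| "comm (BobSends g l r) x y = Suc (if g y then comm l x y else comm r x y)"

text \<open>W = M = {0..<n}. A preference list is a list enumerating {0..<n}, most preferred
first. A profile is a list of n preference lists (entry i is the list of agent i).\<close>

definition pref_list :: "nat \<Rightarrow> nat list \<Rightarrow> bool" where
  "pref_list n l \<longleftrightarrow> distinct l \<and> set l = {..<n}"

definition profile :: "nat \<Rightarrow> nat list list \<Rightarrow> bool" where
  "profile n P \<longleftrightarrow> length P = n \<and> (\<forall>l\<in>set P. pref_list n l)"

definition prefers :: "nat list \<Rightarrow> nat \<Rightarrow> nat \<Rightarrow> bool" where
  "prefers l a b \<longleftrightarrow> (\<exists>i j. i < j \<and> j < length l \<and> l ! i = a \<and> l ! j = b)"

definition perfect_marriage :: "nat \<Rightarrow> (nat \<times> nat) set \<Rightarrow> bool" where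
  "perfect_marriage n \<mu> \<longleftrightarrow> \<mu> \<subseteq> {..<n} \<times> {..<n}
     \<and> (\<forall>w<n. \<exists>!m. (w, m) \<in> \<mu>) \<and> (\<forall>m<n. \<exists>!w. (w, m) \<in> \<mu>)"

definition blocking :: "nat list list \<Rightarrow> nat list list \<Rightarrow> (nat \<times> nat) set \<Rightarrow> nat \<Rightarrow> nat \<Rightarrow> bool" where
  "blocking PW PM \<mu> w m \<longleftrightarrow>
     (\<exists>m'. (w, m') \<in> \<mu> \<and> prefers (PW ! w) m m') \<and>
     (\<exists>w'. (w', m) \<in> \<mu> \<and> prefers (PM ! m) w w')"

definition stable :: "nat \<Rightarrow> nat list list \<Rightarrow> nat list list \<Rightarrow> (nat \<times> nat) set \<Rightarrow> bool" where
  "stable n PW PM \<mu> \<longleftrightarrow> perfect_marriage n \<mu> \<and> (\<forall>w m. \<not> blocking PW PM \<mu> w m)"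

definition in_some_stable :: "nat \<Rightarrow> nat list list \<Rightarrow> nat list list \<Rightarrow> nat \<times> nat \<Rightarrow> bool" where
  "in_some_stable n PW PM p \<longleftrightarrow> (\<exists>\<mu>. stable n PW PM \<mu> \<and> p \<in> \<mu>)"

definition in_every_stable :: "nat \<Rightarrow> nat list list \<Rightarrow> nat list list \<Rightarrow> nat \<times> nat \<Rightarrow> bool" where
  "in_every_stable n PW PM p \<longleftrightarrow> p \<in> {..<n} \<times> {..<n} \<and> (\<forall>\<mu>. stable n PW PM \<mu> \<longrightarrow> p \<in> \<mu>)"

definition good_output ::
  "(nat \<Rightarrow> nat list list \<Rightarrow> nat list list \<Rightarrow> nat \<times> nat \<Rightarrow> bool) \<Rightarrow> real \<Rightarrow> nat
     \<Rightarrow> nat list list \<Rightarrow> nat list list \<Rightarrow> (nat \<times> nat) set \<Rightarrow> bool" where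
  "good_output G eps n PW PM S \<longleftrightarrow> finite S \<and> (\<forall>p\<in>S. G n PW PM p) \<and> eps * real n \<le> real (card S)"

text \<open>A randomized protocol is a probability distribution over deterministic protocol trees.
It solves the task if on every valid input (for which a valid answer exists) it outputs a
valid answer with probability at least 2/3.\<close>
definition solves ::
  "(nat \<Rightarrow> nat list list \<Rightarrow> nat list list \<Rightarrow> nat \<times> nat \<Rightarrow> bool) \<Rightarrow> real \<Rightarrow> nat
     \<Rightarrow> (nat list list, nat list list, (nat \<times> nat) set) prot pmf \<Rightarrow> bool" where
  "solves G eps n P \<longleftrightarrow>
     (\<forall>PW PM. profile n PW \<and> profile n PM \<and> (\<exists>S. good_output G eps n PW PM S) \<longrightarrow>
        measure_pmf.prob P {\<pi>. good_output G eps n PW PM (run \<pi> PW PM)} \<ge> 2/3)"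

definition cost_at_least ::
  "nat \<Rightarrow> (nat list list, nat list list, (nat \<times> nat) set) prot pmf \<Rightarrow> real \<Rightarrow> bool" where
  "cost_at_least n P k \<longleftrightarrow>
     (\<exists>PW PM \<pi>. profile n PW \<and> profile n PM \<and> \<pi> \<in> set_pmf P \<and> k \<le> real (comm \<pi> PW PM))"

end

theory Submission
  imports Defs
begin

text \<open>
  Unique disjointness on \<open>k\<^sup>2\<close> bits with \<open>k = \<lfloor>eps n / 4\<rfloor>\<close> is embedded into a market whose only stable
  marriage is the identity if \<open>x \<inter> y = {}\<close>, whereas a single common element sets off a chain of
  displacements that breaks all but \<open>2 k\<close> pairs of the identity. So \<open>eps n\<close> correct pairs reveal
  which of the two cases holds.

  For disjointness, choose \<open>V \<subseteq> I\<close> and independent uniform \<open>x \<subseteq> V\<close>, \<open>y \<subseteq> I - V\<close>. In a rectangle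
  \<open>A \<times> B\<close> that is not exponentially small, \<open>x \<in> A\<close> is nearly unbiased in almost all coordinates
  of \<open>V\<close>, and likewise for \<open>y\<close>. Hence moving one random coordinate into both sets hardly changes
  the weight of the rectangle, and no cheap protocol can distinguish disjoint pairs from pairs with
  exactly one common element.
\<close>

section \<open>Biased coordinates of set families\<close>

text \<open>For finite \<open>V\<close> this is \<open>2 ^ card V\<close> times the probability that
  a uniform subset of \<open>V\<close> lies in \<open>A\<close>.\<close>

definition below :: "'a set set \<Rightarrow> 'a set \<Rightarrow> real" where
  "below A V = (\<Sum>x\<in>Pow V. indicator A x)"

text \<open>The difference counts members avoiding \<open>i\<close> minus members containing
  \<open>i\<close>: given \<open>x \<in> A\<close>, the probability of \<open>i \<in> x\<close> is
  off from 1/2 by more than \<open>\<kappa> / 2\<close>.\<close>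

definition biased :: "real \<Rightarrow> 'a set set \<Rightarrow> 'a set \<Rightarrow> 'a set" where
  "biased \<kappa> A V = {i \<in> V. \<kappa> * below A V < \<bar>2 * below A (V - {i}) - below A V\<bar>}"

lemma below_nonneg: "0 \<le> below A V"
  unfolding below_def by (intro sum_nonneg) auto

lemma below_le: "finite V \<Longrightarrow> below A V \<le> 2 ^ card V"
proof -
  assume "finite V"
  have "below A V \<le> (\<Sum>x\<in>Pow V. 1)"
    unfolding below_def by (intro sum_mono) (auto simp: indicator_def)
  then show ?thesis using \<open>finite V\<close> by (simp add: card_Pow)
qed

lemma sum_Pow_insert:
  fixes f :: "'a set \<Rightarrow> real"
  assumes "finite T" "i \<notin> T"
  shows "(\<Sum>x\<in>Pow (insert i T). f x) = (\<Sum>x\<in>Pow T. f x) + (\<Sum>x\<in>Pow T. f (insert i x))"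
proof -
  have "inj_on (insert i) (Pow T)" using assms(2) by (auto simp: inj_on_def insert_ident)
  moreover have "Pow T \<inter> insert i ` Pow T = {}" using assms(2) by auto
  ultimately show ?thesis
    using assms(1) by (simp add: Pow_insert sum.union_disjoint sum.reindex)
qed

lemma below_insert:
  assumes "finite T" "i \<notin> T"
  shows "below A (insert i T) = below A T + (\<Sum>x\<in>Pow T. indicator A (insert i x))"
  unfolding below_def by (rule sum_Pow_insert[OF assms])

lemma below_Diff_le:
  assumes "finite V" shows "below A (V - {i}) \<le> below A V"
  unfolding below_def by (rule sum_mono2) (use assms in auto)

text \<open>Moment generating function of independent signs: it factors over the coordinates, and
  each coordinate outside \<open>B\<close> contributes its two choices.\<close>

lemma sum_Pow_exp:
  fixes t :: "'a \<Rightarrow> real"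
  assumes "finite V" "B \<subseteq> V"
  shows "(\<Sum>x\<in>Pow V. exp (\<Sum>i\<in>B. if i \<in> x then - t i else t i))
    = (\<Prod>i\<in>V. if i \<in> B then exp (- t i) + exp (t i) else 2)"
proof -
  define f where "f i = (if i \<in> B then exp (- t i) else 1)" for i
  define g where "g i = (if i \<in> B then exp (t i) else 1)" for i
  have "exp (\<Sum>i\<in>B. if i \<in> x then - t i else t i) = (\<Prod>i\<in>x. f i) * (\<Prod>i\<in>V - x. g i)"
    if "x \<in> Pow V" for x
  proof -
    have x: "x \<subseteq> V" "finite x" using that assms finite_subset by auto
    have "finite B" using assms finite_subset by auto
    then have "exp (\<Sum>i\<in>B. if i \<in> x then - t i else t i)
      = (\<Prod>i\<in>B. if i \<in> x then exp (- t i) else exp (t i))"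
      by (simp add: exp_sum if_distrib)
    also have "\<dots> = (\<Prod>i\<in>V. if i \<in> x then f i else g i)"
      using assms by (intro prod.mono_neutral_cong_left) (auto simp: f_def g_def)
    also have "\<dots> = (\<Prod>i\<in>V \<inter> x. f i) * (\<Prod>i\<in>V \<inter> - x. g i)"
      using assms by (simp add: prod.If_cases)
    also have "V \<inter> x = x" using x by auto
    also have "V \<inter> - x = V - x" by auto
    finally show ?thesis .
  qed
  then have "(\<Sum>x\<in>Pow V. exp (\<Sum>i\<in>B. if i \<in> x then - t i else t i))
    = (\<Sum>x\<in>Pow V. (\<Prod>i\<in>x. f i) * (\<Prod>i\<in>V - x. g i))"
    by (rule sum.cong[OF refl])
  also have "\<dots> = (\<Prod>i\<in>V. f i + g i)" by (rule prod_add[symmetric]) fact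
  also have "\<dots> = (\<Prod>i\<in>V. if i \<in> B then exp (- t i) + exp (t i) else 2)"
    by (rule prod.cong) (auto simp: f_def g_def)
  finally show ?thesis .
qed

text \<open>A crude form of cosh l \<le> exp (l^2 / 2), from 1 / (1 + l) \<le> 1 - l + l^2 and exp l
  \<le> 1 + l + l^2 on [0, 1]; symmetry covers negative l.\<close>

lemma exp_add_exp_minus_le:
  fixes l :: real
  assumes "\<bar>l\<bar> \<le> 1"
  shows "exp (- l) + exp l \<le> 2 * exp (l\<^sup>2)"
proof -
  have *: "exp (- l) + exp l \<le> 2 * exp (l\<^sup>2)" if l: "0 \<le> l" "l \<le> 1" for l :: real
  proof -
    have "1 \<le> (1 + l) * (1 - l + l\<^sup>2)"
      using l by (simp add: algebra_simps power2_eq_square)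
    then have "inverse (1 + l) \<le> 1 - l + l\<^sup>2"
      using l by (simp add: field_simps)
    moreover have "exp (- l) \<le> inverse (1 + l)"
      unfolding exp_minus using l exp_ge_add_one_self[of l] by (intro le_imp_inverse_le) auto
    moreover have "exp l \<le> 1 + l + l\<^sup>2" by (rule exp_bound[OF l])
    moreover have "1 + l\<^sup>2 \<le> exp (l\<^sup>2)" by (rule exp_ge_add_one_self)
    ultimately show ?thesis by linarith
  qed
  show ?thesis
    using *[of l] *[of "- l"] assms by (cases "0 \<le> l") auto
qed

text \<open>Chernoff bound in disguise: a family of subsets of \<open>V\<close> with many biased coordinates
  has a large exponential moment in the direction of the biases, hence it is small.\<close>

lemma below_le_exp_biased:
  assumes "finite V" "0 \<le> \<kappa>" "\<kappa> \<le> 1"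
  shows "below A V \<le> 2 ^ card V * exp (- (\<kappa>\<^sup>2 / 4) * real (card (biased \<kappa> A V)))"
proof -
  define B where "B = biased \<kappa> A V"
  define k where "k = real (card B)"
  define a where "a = \<kappa>\<^sup>2 / 2 * k"
  define d where "d i = 2 * below A (V - {i}) - below A V" for i
  \<comment> \<open>The signs follow the biases, so every coordinate of \<open>B\<close> raises the
    mean of \<open>Z\<close> over \<open>A\<close>. With step size s the gain per coordinate is s *
    \<kappa> - s^2, which is largest at s = \<open>\<kappa> / 2\<close>.\<close>
  define t where "t i = \<kappa> / 2 * (if d i \<ge> 0 then 1 else -1)" for i
  define Z where "Z x = (\<Sum>i\<in>B. if i \<in> x then - t i else t i)" for x
  have B: "B \<subseteq> V" unfolding B_def biased_def by auto
  then have "finite B" using assms finite_subset by auto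
  have dif: "(\<Sum>x\<in>Pow V. indicator A x * (if i \<in> x then - t i else t i)) = t i * d i"
    if "i \<in> V" for i
  proof -
    define T where "T = V - {i}"
    have T: "V = insert i T" "i \<notin> T" "finite T" using that assms T_def by auto
    have 1: "(\<Sum>x\<in>Pow T. indicator A x * (if i \<in> x then - t i else t i)) = t i * below A T"
      unfolding below_def sum_distrib_left using T by (intro sum.cong) auto
    have 2: "(\<Sum>x\<in>Pow T. indicator A (insert i x) * (if i \<in> insert i x then - t i else t i))
      = - t i * (below A V - below A T)"
      unfolding T(1) below_insert[OF T(3,2)] by (simp add: sum_distrib_left mult_ac sum_negf)
    have "(\<Sum>x\<in>Pow V. indicator A x * (if i \<in> x then - t i else t i))
      = t i * below A T - t i * (below A V - below A T)"
      unfolding T(1) sum_Pow_insert[OF T(3,2)] unfolding T(1)[symmetric] 1 2 by simp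
    then show ?thesis unfolding d_def T_def[symmetric] by (simp add: algebra_simps)
  qed
  have "a * below A V = (\<Sum>i\<in>B. \<kappa> / 2 * (\<kappa> * below A V))"
    by (simp add: a_def k_def power2_eq_square)
  also have "\<dots> \<le> (\<Sum>i\<in>B. t i * d i)"
  proof (intro sum_mono)
    fix i assume "i \<in> B"
    then have "\<kappa> * below A V \<le> \<bar>d i\<bar>" unfolding B_def biased_def d_def by auto
    then have "\<kappa> / 2 * (\<kappa> * below A V) \<le> \<kappa> / 2 * \<bar>d i\<bar>"
      using assms by (intro mult_left_mono) auto
    also have "\<dots> = t i * d i" unfolding t_def by auto
    finally show "\<kappa> / 2 * (\<kappa> * below A V) \<le> t i * d i" .
  qed
  also have "\<dots> = (\<Sum>i\<in>B. \<Sum>x\<in>Pow V. indicator A x * (if i \<in> x then - t i else t i))"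
    using B dif by (intro sum.cong) auto
  also have "\<dots> = (\<Sum>x\<in>Pow V. indicator A x * Z x)"
    unfolding Z_def sum_distrib_left by (rule sum.swap)
  finally have Zge: "a * below A V \<le> (\<Sum>x\<in>Pow V. indicator A x * Z x)" .
  \<comment> \<open>Jensen by hand: exp lies above its tangent at \<open>a\<close>, and the mean of
    \<open>Z\<close> over \<open>A\<close> is at least \<open>a\<close>.\<close>
  have "exp a * below A V \<le> exp a * ((1 - a) * below A V + (\<Sum>x\<in>Pow V. indicator A x * Z x))"
    using Zge by (intro mult_left_mono) (auto simp: algebra_simps)
  also have "\<dots> = (\<Sum>x\<in>Pow V. indicator A x * (exp a * (1 + (Z x - a))))"
    unfolding below_def sum_distrib_left sum.distrib[symmetric] by (intro sum.cong) (auto simp: algebra_simps)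
  also have "\<dots> \<le> (\<Sum>x\<in>Pow V. exp (Z x))"
  proof (intro sum_mono)
    fix x
    have "exp a * (1 + (Z x - a)) \<le> exp a * exp (Z x - a)"
      by (intro mult_left_mono exp_ge_add_one_self) auto
    also have "\<dots> = exp (Z x)" by (simp flip: exp_add)
    finally show "indicator A x * (exp a * (1 + (Z x - a))) \<le> exp (Z x)"
      by (auto simp: indicator_def)
  qed
  also have "\<dots> = (\<Prod>i\<in>V. if i \<in> B then exp (- t i) + exp (t i) else 2)"
    unfolding Z_def by (rule sum_Pow_exp[OF assms(1) B])
  also have "\<dots> \<le> (\<Prod>i\<in>V. 2 * (if i \<in> B then exp (\<kappa>\<^sup>2 / 4) else 1))"
  proof (intro prod_mono conjI)
    fix i
    have "exp (- t i) + exp (t i) \<le> 2 * exp ((t i)\<^sup>2)"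
      by (rule exp_add_exp_minus_le) (use assms in \<open>auto simp: t_def\<close>)
    also have "(t i)\<^sup>2 = \<kappa>\<^sup>2 / 4" unfolding t_def by (auto simp: power2_eq_square)
    finally show "(if i \<in> B then exp (- t i) + exp (t i) else 2)
      \<le> 2 * (if i \<in> B then exp (\<kappa>\<^sup>2 / 4) else 1)" by auto
    show "0 \<le> (if i \<in> B then exp (- t i) + exp (t i) else 2)" by simp
  qed
  also have "\<dots> = 2 ^ card V * (\<Prod>i\<in>B. exp (\<kappa>\<^sup>2 / 4))"
  proof -
    have "(\<Prod>i\<in>V. if i \<in> B then exp (\<kappa>\<^sup>2 / 4) else 1) = (\<Prod>i\<in>B. exp (\<kappa>\<^sup>2 / 4))"
      using assms B by (intro prod.mono_neutral_cong_right) auto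
    then show ?thesis by (simp add: prod.distrib)
  qed
  also have "\<dots> = 2 ^ card V * exp (\<kappa>\<^sup>2 / 4 * k)"
    unfolding k_def exp_of_nat2_mult by simp
  also have "\<dots> = exp a * (2 ^ card V * exp (\<kappa>\<^sup>2 / 4 * k - a))"
    by (simp add: exp_diff)
  finally have "below A V \<le> 2 ^ card V * exp (\<kappa>\<^sup>2 / 4 * k - a)"
    by (rule mult_left_le_imp_le) simp
  also have "\<kappa>\<^sup>2 / 4 * k - a = - (\<kappa>\<^sup>2 / 4) * k" by (simp add: a_def)
  finally show ?thesis unfolding k_def B_def .
qed

section \<open>Unique disjointness\<close>

text \<open>The auxiliary sets \<open>V\<close> and \<open>T\<close> weight each pair by the number of ways to separate it; once
  they are fixed, \<open>x\<close> and \<open>y\<close> range independently. The sums have \<open>4 ^ card I\<close> and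
  \<open>card I * 4 ^ (card I - 1)\<close> terms.\<close>

definition disj_sum :: "'a set \<Rightarrow> ('a set \<Rightarrow> 'a set \<Rightarrow> real) \<Rightarrow> real" where
  "disj_sum I h = (\<Sum>V\<in>Pow I. \<Sum>x\<in>Pow V. \<Sum>y\<in>Pow (I - V). h x y)"

definition uint_sum :: "'a set \<Rightarrow> ('a set \<Rightarrow> 'a set \<Rightarrow> real) \<Rightarrow> real" where
  "uint_sum I h = (\<Sum>i\<in>I. \<Sum>T\<in>Pow (I - {i}). \<Sum>x\<in>Pow T. \<Sum>y\<in>Pow (I - {i} - T).
     h (insert i x) (insert i y))"

text \<open>A pair (i, T) with \<open>i \<notin> T\<close> has two readings:
  \<open>V = insert i T\<close>, with \<open>i\<close> on Alice's side, or \<open>V = T\<close>,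
  with \<open>i\<close> on Bob's side. The first suits biases of \<open>A\<close>, the second those
  of \<open>B\<close>.\<close>

lemma sum_Pow_remove:
  fixes \<phi> :: "'a \<Rightarrow> 'a set \<Rightarrow> real"
  assumes "finite I"
  shows "(\<Sum>i\<in>I. \<Sum>T\<in>Pow (I - {i}). \<phi> i T) = (\<Sum>V\<in>Pow I. \<Sum>i\<in>V. \<phi> i (V - {i}))"
    and "(\<Sum>i\<in>I. \<Sum>T\<in>Pow (I - {i}). \<phi> i T) = (\<Sum>V\<in>Pow I. \<Sum>i\<in>I - V. \<phi> i V)"
proof -
  have fin: "finite V" if "V \<in> Pow I" for V using that assms finite_subset by auto
  have S: "(\<Sum>i\<in>I. \<Sum>T\<in>Pow (I - {i}). \<phi> i T)
    = (\<Sum>(i, T)\<in>(SIGMA i:I. Pow (I - {i})). \<phi> i T)"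
    using assms by (subst sum.Sigma) auto
  also have "\<dots> = (\<Sum>(V, i)\<in>(SIGMA V:Pow I. V). \<phi> i (V - {i}))"
    by (rule sum.reindex_bij_witness[where i = "\<lambda>(V, i). (i, V - {i})"
        and j = "\<lambda>(i, T). (insert i T, i)"])
      (auto intro!: arg_cong[where f = "\<phi> _"])
  also have "\<dots> = (\<Sum>V\<in>Pow I. \<Sum>i\<in>V. \<phi> i (V - {i}))"
    using assms fin by (subst sum.Sigma) auto
  finally show "(\<Sum>i\<in>I. \<Sum>T\<in>Pow (I - {i}). \<phi> i T) = (\<Sum>V\<in>Pow I. \<Sum>i\<in>V. \<phi> i (V - {i}))" .
  have "(\<Sum>(i, T)\<in>(SIGMA i:I. Pow (I - {i})). \<phi> i T) = (\<Sum>(V, i)\<in>(SIGMA V:Pow I. I - V). \<phi> i V)"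
    by (rule sum.reindex_bij_witness[where i = "\<lambda>(V, i). (i, V)" and j = "\<lambda>(i, V). (V, i)"]) auto
  also have "\<dots> = (\<Sum>V\<in>Pow I. \<Sum>i\<in>I - V. \<phi> i V)"
    using assms by (subst sum.Sigma) auto
  finally show "(\<Sum>i\<in>I. \<Sum>T\<in>Pow (I - {i}). \<phi> i T) = (\<Sum>V\<in>Pow I. \<Sum>i\<in>I - V. \<phi> i V)"
    using S by simp
qed

section \<open>Rectangles: weight on disjoint versus uniquely intersecting pairs\<close>

lemma sum_if_mem_card:
  fixes c :: real
  assumes "finite V" "B \<subseteq> V"
  shows "(\<Sum>i\<in>V. if i \<in> B then c else 0) = real (card B) * c"
proof -
  have "(\<Sum>i\<in>V. if i \<in> B then c else 0) = (\<Sum>i\<in>B. c)"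
    using assms by (intro sum.mono_neutral_cong_right) auto
  then show ?thesis by simp
qed

lemma disj_sum_rectangle:
  "disj_sum I (\<lambda>x y. indicator A x * indicator B y) = (\<Sum>V\<in>Pow I. below A V * below B (I - V))"
  unfolding disj_sum_def below_def sum_product ..

lemma uint_sum_rectangle:
  assumes "finite I"
  shows "uint_sum I (\<lambda>x y. indicator A x * indicator B y) = (\<Sum>i\<in>I. \<Sum>T\<in>Pow (I - {i}).
    (below A (insert i T) - below A T) * (below B (I - T) - below B (I - {i} - T)))"
  unfolding uint_sum_def
proof (intro sum.cong refl)
  fix i T assume iT: "i \<in> I" "T \<in> Pow (I - {i})"
  have T: "finite T" "i \<notin> T" "finite (I - {i} - T)" "i \<notin> I - {i} - T"
    using iT assms finite_subset[of T I] by auto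
  have "insert i (I - {i} - T) = I - T" using iT by auto
  then have "below B (I - T) - below B (I - {i} - T)
    = (\<Sum>y\<in>Pow (I - {i} - T). indicator B (insert i y))"
    using below_insert[OF T(3,4), of B] by simp
  moreover have "below A (insert i T) - below A T = (\<Sum>x\<in>Pow T. indicator A (insert i x))"
    using below_insert[OF T(1,2), of A] by simp
  ultimately show "(\<Sum>x\<in>Pow T. \<Sum>y\<in>Pow (I - {i} - T). indicator A (insert i x) * indicator B (insert i y))
    = (below A (insert i T) - below A T) * (below B (I - T) - below B (I - {i} - T))"
    by (simp add: sum_product)
qed

text \<open>The share of members avoiding \<open>i\<close> lies between 19/40 and 21/40, so the
  ratio of containing to avoiding is at least 19/21.\<close>

lemma unbiased_bounds:
  assumes "i \<in> V" "i \<notin> biased (1/20) A V"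
  shows "19/21 * below A (V - {i}) \<le> below A V - below A (V - {i})"
    and "19/40 * below A V \<le> below A (V - {i})"
  using assms unfolding biased_def mem_Collect_eq by linarith+

text \<open>The error exponent is \<open>320000 = 200 * 4 / (1/20)\<^sup>2\<close>: a family that is not exponentially small
  has at most a fraction \<open>1/200\<close> of coordinates of bias more than \<open>1/20\<close>. These two parameters are
  small enough to make the constant \<open>1/6\<close> in \<open>uint_sum_rectangle_ge\<close> larger than \<open>1/8\<close>, which is what
  success probability \<open>2/3\<close> requires.\<close>

lemma card_biased_le:
  assumes "finite I" "V \<subseteq> I" "2 ^ card V * exp (- real (card I) / 320000) < below A V"
  shows "real (card (biased (1/20) A V)) \<le> real (card I) / 200"
proof -
  have fin: "finite V" using assms finite_subset by auto
  have "2 ^ card V * exp (- real (card I) / 320000)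
    < 2 ^ card V * exp (- ((1/20)\<^sup>2 / 4) * real (card (biased (1/20) A V)))"
    using below_le_exp_biased[OF fin, of "1/20" A] by (intro less_le_trans[OF assms(3)]) simp
  then have "exp (- real (card I) / 320000) < exp (- ((1/20)\<^sup>2 / 4) * real (card (biased (1/20) A V)))"
    by (rule mult_left_less_imp_less) simp
  then show ?thesis unfolding exp_less_cancel_iff by (simp add: power2_eq_square)
qed

text \<open>Adding \<open>i\<close> to both sets costs a factor of at most (19/21)^2 = 361/441 when
  \<open>i\<close> is unbiased on both sides; biased \<open>i\<close> are subtracted in full through
  \<open>pA\<close> and \<open>pB\<close>. Averaging two lower bounds for the sum of
  \<open>p\<close> gives 1/2 * 19/40 = 19/80 per coordinate, so a biased one costs 19/80 + 1 =
  99/80.\<close>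

lemma uint_sum_rectangle_ge_biased:
  assumes "finite I"
  shows "361/441 * (\<Sum>V\<in>Pow I. (19/80 * real (card I) -
      99/80 * (real (card (biased (1/20) A V)) + real (card (biased (1/20) B (I - V)))))
        * (below A V * below B (I - V)))
    \<le> uint_sum I (\<lambda>x y. indicator A x * indicator B y)"
proof -
  let ?bA = "biased (1/20) A" and ?bB = "biased (1/20) B"
  let ?a = "below A" and ?b = "below B"
  let ?\<Sigma> = "\<lambda>\<phi> :: 'a \<Rightarrow> 'a set \<Rightarrow> real. \<Sum>i\<in>I. \<Sum>T\<in>Pow (I - {i}). \<phi> i T"
  \<comment> \<open>Weight of the rectangle on disjoint pairs that omit \<open>i\<close> and are
    separated by \<open>T\<close>.\<close>
  define p where "p = (\<lambda>i T. ?a T * ?b (I - {i} - T))"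
  define pA where "pA = (\<lambda>i T. if i \<in> ?bA (insert i T) then p i T else 0)"
  define pB where "pB = (\<lambda>i T. if i \<in> ?bB (I - T) then p i T else 0)"
  have fin: "finite V" if "V \<in> Pow I" for V using that assms finite_subset by auto
  have p0: "0 \<le> p i T" for i T unfolding p_def by (intro mult_nonneg_nonneg below_nonneg)
  have bsub: "?bA V \<subseteq> V" "?bB V \<subseteq> V" for V unfolding biased_def by auto

  have bound: "361/441 * (p i T - pA i T - pB i T)
      \<le> (?a (insert i T) - ?a T) * (?b (I - T) - ?b (I - {i} - T))"
    if "i \<in> I" "T \<in> Pow (I - {i})" for i T
  proof -
    have i: "i \<notin> T" "i \<in> I - T" "I - T - {i} = I - {i} - T" "finite (insert i T)" "finite (I - T)"
      using that assms finite_subset[of T I] by auto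
    have T: "insert i T - {i} = T" using i by auto
    have a: "0 \<le> ?a (insert i T) - ?a T" using below_Diff_le[OF i(4), of A i] T by simp
    have b: "0 \<le> ?b (I - T) - ?b (I - {i} - T)" using below_Diff_le[OF i(5), of B i] i by simp
    show ?thesis
    proof (cases "i \<in> ?bA (insert i T) \<or> i \<in> ?bB (I - T)")
      case True
      then have "361/441 * (p i T - pA i T - pB i T) \<le> 0"
        using p0[of i T] unfolding pA_def pB_def by auto
      moreover have "0 \<le> (?a (insert i T) - ?a T) * (?b (I - T) - ?b (I - {i} - T))"
        using a b by (rule mult_nonneg_nonneg)
      ultimately show ?thesis by (rule order_trans)
    next
      case False
      then have "19/21 * ?a T \<le> ?a (insert i T) - ?a T"
        using unbiased_bounds(1)[of i "insert i T" A] T by simp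
      moreover have "19/21 * ?b (I - {i} - T) \<le> ?b (I - T) - ?b (I - {i} - T)"
        using unbiased_bounds(1)[of i "I - T" B] i False by simp
      ultimately have "(19/21 * ?a T) * (19/21 * ?b (I - {i} - T))
        \<le> (?a (insert i T) - ?a T) * (?b (I - T) - ?b (I - {i} - T))"
        using a by (intro mult_mono) (auto simp: below_nonneg)
      moreover have "pA i T = 0" "pB i T = 0" using False unfolding pA_def pB_def by auto
      ultimately show ?thesis unfolding p_def by simp
    qed
  qed

  have idiff: "I - {i} - (V - {i}) = I - V" "insert i (V - {i}) = V" if "i \<in> V" for i V
    using that by auto

  have SA: "?\<Sigma> pA \<le> (\<Sum>V\<in>Pow I. real (card (?bA V)) * (?a V * ?b (I - V)))"
    unfolding sum_Pow_remove(1)[OF assms]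
  proof (intro sum_mono)
    fix V assume V: "V \<in> Pow I"
    have "(\<Sum>i\<in>V. pA i (V - {i})) \<le> (\<Sum>i\<in>V. if i \<in> ?bA V then ?a V * ?b (I - V) else 0)"
      unfolding pA_def p_def using below_Diff_le[OF fin[OF V]]
      by (intro sum_mono) (auto simp: idiff insert_absorb intro!: mult_right_mono below_nonneg)
    also have "\<dots> = real (card (?bA V)) * (?a V * ?b (I - V))"
      by (rule sum_if_mem_card[OF fin[OF V] bsub(1)])
    finally show "(\<Sum>i\<in>V. pA i (V - {i})) \<le> real (card (?bA V)) * (?a V * ?b (I - V))" .
  qed

  have SB: "?\<Sigma> pB \<le> (\<Sum>V\<in>Pow I. real (card (?bB (I - V))) * (?a V * ?b (I - V)))"
    unfolding sum_Pow_remove(2)[OF assms]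
  proof (intro sum_mono)
    fix V assume V: "V \<in> Pow I"
    have f: "finite (I - V)" using assms by auto
    have e: "I - {i} - V = I - V - {i}" for i by auto
    have "(\<Sum>i\<in>I - V. pB i V) \<le> (\<Sum>i\<in>I - V. if i \<in> ?bB (I - V) then ?a V * ?b (I - V) else 0)"
      unfolding pB_def p_def e using below_Diff_le[OF f]
      by (intro sum_mono) (auto intro!: mult_left_mono below_nonneg)
    also have "\<dots> = real (card (?bB (I - V))) * (?a V * ?b (I - V))"
      by (rule sum_if_mem_card[OF f bsub(2)])
    finally show "(\<Sum>i\<in>I - V. pB i V) \<le> real (card (?bB (I - V))) * (?a V * ?b (I - V))" .
  qed

  \<comment> \<open>Dropping an unbiased \<open>i\<close> from Alice's side of \<open>V\<close>
    keeps at least 19/40 of the weight of \<open>V\<close>; \<open>PB\<close> does the same on Bob's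
    side.\<close>
  have PA: "(\<Sum>V\<in>Pow I. 19/40 * (real (card V) - real (card (?bA V))) * (?a V * ?b (I - V))) \<le> ?\<Sigma> p"
    unfolding sum_Pow_remove(1)[OF assms]
  proof (intro sum_mono)
    fix V assume V: "V \<in> Pow I"
    have "real (card V) - real (card (?bA V)) = real (card (V - ?bA V))"
      using fin[OF V] bsub(1)[of V] by (simp add: card_Diff_subset finite_subset card_mono of_nat_diff)
    then have "19/40 * (real (card V) - real (card (?bA V))) * (?a V * ?b (I - V))
      = (\<Sum>i\<in>V - ?bA V. 19/40 * ?a V * ?b (I - V))" by simp
    also have "\<dots> \<le> (\<Sum>i\<in>V - ?bA V. p i (V - {i}))"
    proof (intro sum_mono)
      fix i assume "i \<in> V - ?bA V"
      then show "19/40 * ?a V * ?b (I - V) \<le> p i (V - {i})"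
        using mult_right_mono[OF unbiased_bounds(2)[of i V A] below_nonneg[of B "I - V"]]
        by (simp add: p_def idiff)
    qed
    also have "\<dots> \<le> (\<Sum>i\<in>V. p i (V - {i}))"
      using fin[OF V] p0 by (intro sum_mono2) auto
    finally show "19/40 * (real (card V) - real (card (?bA V))) * (?a V * ?b (I - V))
      \<le> (\<Sum>i\<in>V. p i (V - {i}))" .
  qed

  have PB: "(\<Sum>V\<in>Pow I. 19/40 * (real (card (I - V)) - real (card (?bB (I - V)))) * (?a V * ?b (I - V))) \<le> ?\<Sigma> p"
    unfolding sum_Pow_remove(2)[OF assms]
  proof (intro sum_mono)
    fix V assume V: "V \<in> Pow I"
    have f: "finite (I - V)" using assms by auto
    have e: "I - {i} - V = I - V - {i}" for i by auto
    have "real (card (I - V)) - real (card (?bB (I - V))) = real (card (I - V - ?bB (I - V)))"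
      using f bsub(2)[of "I - V"] by (simp add: card_Diff_subset finite_subset card_mono of_nat_diff)
    then have "19/40 * (real (card (I - V)) - real (card (?bB (I - V)))) * (?a V * ?b (I - V))
      = (\<Sum>i\<in>I - V - ?bB (I - V). ?a V * (19/40 * ?b (I - V)))" by simp
    also have "\<dots> \<le> (\<Sum>i\<in>I - V - ?bB (I - V). p i V)"
    proof (intro sum_mono)
      fix i assume "i \<in> I - V - ?bB (I - V)"
      then show "?a V * (19/40 * ?b (I - V)) \<le> p i V"
        using mult_left_mono[OF unbiased_bounds(2)[of i "I - V" B] below_nonneg[of A V]]
        by (simp add: p_def e)
    qed
    also have "\<dots> \<le> (\<Sum>i\<in>I - V. p i V)"
      using f p0 by (intro sum_mono2) auto
    finally show "19/40 * (real (card (I - V)) - real (card (?bB (I - V)))) * (?a V * ?b (I - V))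
      \<le> (\<Sum>i\<in>I - V. p i V)" .
  qed

  let ?w = "\<lambda>V. ?a V * ?b (I - V)"
  have cardV: "real (card V) + real (card (I - V)) = real (card I)" if "V \<in> Pow I" for V
    using that assms fin[OF that] by (simp add: card_Diff_subset card_mono of_nat_diff)
  \<comment> \<open>Taking half of \<open>PA\<close> and half of \<open>PB\<close> makes the sizes
    of \<open>V\<close> and \<open>I - V\<close> add up to \<open>card I\<close> for every
    \<open>V\<close>.\<close>
  have "(\<Sum>V\<in>Pow I. (19/80 * real (card I) - 99/80 * (real (card (?bA V)) + real (card (?bB (I - V))))) * ?w V)
    = (\<Sum>V\<in>Pow I. 1/2 * (19/40 * (real (card V) - real (card (?bA V))) * ?w V)
        + 1/2 * (19/40 * (real (card (I - V)) - real (card (?bB (I - V)))) * ?w V)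
        - real (card (?bA V)) * ?w V - real (card (?bB (I - V))) * ?w V)"
    by (intro sum.cong refl) (simp add: cardV[symmetric] algebra_simps)
  also have "\<dots> = 1/2 * (\<Sum>V\<in>Pow I. 19/40 * (real (card V) - real (card (?bA V))) * ?w V)
     + 1/2 * (\<Sum>V\<in>Pow I. 19/40 * (real (card (I - V)) - real (card (?bB (I - V)))) * ?w V)
     - (\<Sum>V\<in>Pow I. real (card (?bA V)) * ?w V) - (\<Sum>V\<in>Pow I. real (card (?bB (I - V))) * ?w V)"
    by (simp only: sum.distrib sum_subtractf sum_distrib_left)
  also have "\<dots> \<le> ?\<Sigma> p - ?\<Sigma> pA - ?\<Sigma> pB"
    using PA PB SA SB by linarith
  also have "\<dots> = ?\<Sigma> (\<lambda>i T. p i T - pA i T - pB i T)"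
    by (simp only: sum_subtractf)
  finally have "361/441 * (\<Sum>V\<in>Pow I. (19/80 * real (card I) - 99/80 * (real (card (?bA V)) + real (card (?bB (I - V))))) * ?w V)
    \<le> ?\<Sigma> (\<lambda>i T. 361/441 * (p i T - pA i T - pB i T))"
    by (simp only: sum_distrib_left[symmetric] mult_left_mono)
  also have "\<dots> \<le> uint_sum I (\<lambda>x y. indicator A x * indicator B y)"
    unfolding uint_sum_rectangle[OF assms] by (intro sum_mono bound)
  finally show ?thesis .
qed

text \<open>If both slices at \<open>V\<close> exceed the threshold, few coordinates are biased and
  the main term survives. Otherwise the weight at \<open>V\<close> is exponentially small and the
  error term absorbs it.\<close>

lemma uint_sum_rectangle_ge:
  assumes "finite I"
  shows "real (card I) / 6 * disj_sum I (\<lambda>x y. indicator A x * indicator B y)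
      - real (card I) * 4 ^ card I * exp (- real (card I) / 320000)
    \<le> uint_sum I (\<lambda>x y. indicator A x * indicator B y)"
proof -
  let ?N = "real (card I)" and ?\<theta> = "exp (- real (card I) / 320000)"
  let ?k = "\<lambda>V. real (card (biased (1/20) A V)) + real (card (biased (1/20) B (I - V)))"
  let ?w = "\<lambda>V. below A V * below B (I - V)"
  have *: "?N / 6 * ?w V - ?N * 2 ^ card I * ?\<theta> \<le> 361/441 * ((19/80 * ?N - 99/80 * ?k V) * ?w V)"
    if V: "V \<in> Pow I" for V
  proof -
    have fV: "finite V" "finite (I - V)" using that assms finite_subset by auto
    have card: "card I = card V + card (I - V)"
      using V assms fV by (simp add: card_Diff_subset card_mono)
    have w0: "0 \<le> ?w V" by (intro mult_nonneg_nonneg below_nonneg)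
    show ?thesis
    proof (cases "2 ^ card V * ?\<theta> < below A V \<and> 2 ^ card (I - V) * ?\<theta> < below B (I - V)")
      case True
      then have "?k V \<le> ?N / 200 + ?N / 200"
        using V by (intro add_mono card_biased_le assms) auto
      \<comment> \<open>Here 99/80 * 1/100 < 1/80 leaves 18/80 = 9/40, and 361/441 * 9/40 >
        1/6.\<close>
      then have "9/40 * ?N \<le> 19/80 * ?N - 99/80 * ?k V"
        using of_nat_0_le_iff[of "card I", where ?'a = real] by (simp add: field_simps)
      then have "361/441 * (9/40 * ?N) \<le> 361/441 * (19/80 * ?N - 99/80 * ?k V)"
        by (rule mult_left_mono) simp
      then have "?N / 6 \<le> 361/441 * (19/80 * ?N - 99/80 * ?k V)"
        by (rule order_trans[rotated]) simp
      then have "?N / 6 * ?w V \<le> 361/441 * (19/80 * ?N - 99/80 * ?k V) * ?w V"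
        using w0 by (rule mult_right_mono)
      moreover have "0 \<le> ?N * 2 ^ card I * ?\<theta>" by simp
      ultimately show ?thesis by linarith
    next
      case False
      have "?w V \<le> 2 ^ card I * ?\<theta>"
      proof (cases "2 ^ card V * ?\<theta> < below A V")
        case True
        then have "?w V \<le> 2 ^ card V * (2 ^ card (I - V) * ?\<theta>)"
          using False fV by (intro mult_mono below_le below_nonneg) auto
        then show ?thesis by (simp add: card power_add)
      next
        case False
        then have "?w V \<le> (2 ^ card V * ?\<theta>) * 2 ^ card (I - V)"
          using fV by (intro mult_mono below_le below_nonneg) auto
        then show ?thesis by (simp add: card power_add mult_ac)
      qed
      then have "?N * ?w V \<le> ?N * (2 ^ card I * ?\<theta>)" by (rule mult_left_mono) simp
      moreover have "?k V \<le> ?N"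
      proof -
        have "card (biased (1/20) A V) \<le> card V" "card (biased (1/20) B (I - V)) \<le> card (I - V)"
          using fV by (auto intro!: card_mono simp: biased_def)
        then show ?thesis unfolding card by simp
      qed
      then have "?k V * ?w V \<le> ?N * ?w V" using w0 by (rule mult_right_mono)
      moreover have "0 \<le> ?N * ?w V" using w0 by simp
      \<comment> \<open>The right side is at least -361/441 * P, the left at most -5/6 * P, and
        361/441 < 5/6.\<close>
      moreover have "P / 6 - R \<le> 361/441 * (19/80 * P - 99/80 * K)"
        if "P \<le> R" "K \<le> P" "0 \<le> P" for P K R :: real
        using that by (simp add: field_simps)
      ultimately have "?N * ?w V / 6 - ?N * (2 ^ card I * ?\<theta>)
        \<le> 361/441 * (19/80 * (?N * ?w V) - 99/80 * (?k V * ?w V))" by blast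
      then show ?thesis by (simp only: left_diff_distrib mult.assoc times_divide_eq_left)
    qed
  qed
  have "(4::real) ^ card I = 2 ^ card I * 2 ^ card I" by (simp flip: power_mult_distrib)
  then have "?N / 6 * disj_sum I (\<lambda>x y. indicator A x * indicator B y) - ?N * 4 ^ card I * ?\<theta>
    = (\<Sum>V\<in>Pow I. ?N / 6 * ?w V - ?N * 2 ^ card I * ?\<theta>)"
    using assms by (simp add: disj_sum_rectangle sum_subtractf sum_distrib_left card_Pow)
  also have "\<dots> \<le> (\<Sum>V\<in>Pow I. 361/441 * ((19/80 * ?N - 99/80 * ?k V) * ?w V))"
    by (intro sum_mono *)
  also have "\<dots> = 361/441 * (\<Sum>V\<in>Pow I. (19/80 * ?N - 99/80 * ?k V) * ?w V)"
    by (simp only: sum_distrib_left)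
  also have "\<dots> \<le> uint_sum I (\<lambda>x y. indicator A x * indicator B y)"
    by (rule uint_sum_rectangle_ge_biased[OF assms])
  finally show ?thesis .
qed

section \<open>From rectangles to deterministic and randomized protocols\<close>

lemma disj_sum_add: "disj_sum I (\<lambda>x y. f x y + g x y) = disj_sum I f + disj_sum I g"
  unfolding disj_sum_def by (simp add: sum.distrib)

lemma uint_sum_add: "uint_sum I (\<lambda>x y. f x y + g x y) = uint_sum I f + uint_sum I g"
  unfolding uint_sum_def by (simp add: sum.distrib)

lemma disj_sum_const:
  assumes "finite I" shows "disj_sum I (\<lambda>x y. c) = c * 4 ^ card I"
proof -
  have "disj_sum I (\<lambda>x y. c) = (\<Sum>V\<in>Pow I. c * 2 ^ card I)"
    unfolding disj_sum_def
  proof (intro sum.cong refl)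
    fix V assume "V \<in> Pow I"
    then have "finite V" "card I = card V + card (I - V)"
      using assms finite_subset[of V I] by (auto simp: card_Diff_subset card_mono)
    then show "(\<Sum>x\<in>Pow V. \<Sum>y\<in>Pow (I - V). c) = c * 2 ^ card I"
      using assms by (simp add: card_Pow power_add)
  qed
  also have "\<dots> = c * 4 ^ card I"
    using assms by (simp add: card_Pow flip: power_mult_distrib)
  finally show ?thesis .
qed

text \<open>The factor 4 on the left avoids the truncated exponent
  \<open>card I - 1\<close>.\<close>

lemma uint_sum_const:
  assumes "finite I" shows "4 * uint_sum I (\<lambda>x y. c) = c * real (card I) * 4 ^ card I"
proof -
  have "uint_sum I (\<lambda>x y. c) = (\<Sum>i\<in>I. disj_sum (I - {i}) (\<lambda>x y. c))"
    unfolding uint_sum_def disj_sum_def ..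
  then have "4 * uint_sum I (\<lambda>x y. c) = (\<Sum>i\<in>I. 4 * disj_sum (I - {i}) (\<lambda>x y. c))"
    by (simp add: sum_distrib_left)
  also have "\<dots> = (\<Sum>i\<in>I. c * 4 ^ card I)"
  proof (intro sum.cong refl)
    fix i assume "i \<in> I"
    then have "card I = Suc (card (I - {i}))" using assms by (metis card_Suc_Diff1)
    then show "4 * disj_sum (I - {i}) (\<lambda>x y. c) = c * 4 ^ card I"
      using assms by (simp add: disj_sum_const)
  qed
  finally show ?thesis by simp
qed

text \<open>Every leaf of a protocol tree is reached by a combinatorial rectangle of inputs.\<close>

lemma protocol_corruption:
  fixes p :: "('x, 'y, 'o) prot" and I :: "'a set"
  assumes "finite I" and "\<And>x y. x \<in> A \<Longrightarrow> y \<in> B \<Longrightarrow> comm p (eA x) (eB y) \<le> C"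
  shows "real (card I) / 6 * disj_sum I (\<lambda>x y. indicator A x * indicator B y * of_bool (Q (run p (eA x) (eB y))))
      - uint_sum I (\<lambda>x y. indicator A x * indicator B y * of_bool (Q (run p (eA x) (eB y))))
    \<le> 2 ^ C * (real (card I) * 4 ^ card I * exp (- real (card I) / 320000))"
  using assms(2)
proof (induction p arbitrary: A B C)
  case (Out v)
  let ?\<tau> = "real (card I) * 4 ^ card I * exp (- real (card I) / 320000)"
  have "1 * ?\<tau> \<le> 2 ^ C * ?\<tau>" by (intro mult_right_mono) auto
  moreover have "0 \<le> ?\<tau>" by simp
  ultimately show ?case
    using uint_sum_rectangle_ge[OF assms(1), of A B]
    by (cases "Q v") (simp_all add: disj_sum_def uint_sum_def)
next
  case (AliceSends f l r)
  let ?\<tau> = "real (card I) * 4 ^ card I * exp (- real (card I) / 320000)"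
  let ?h = "\<lambda>p A B x y. indicator A x * indicator B y * of_bool (Q (run p (eA x) (eB y))) :: real"
  show ?case
  proof (cases "A = {} \<or> B = {}")
    case True
    then show ?thesis by (auto simp: disj_sum_def uint_sum_def)
  next
    case False
    \<comment> \<open>A nonempty rectangle forces a budget of at least one bit, so both children run
      on \<open>C'\<close>. The message splits \<open>A\<close>, and the two errors with factor
      \<open>2 ^ C'\<close> add up to one with \<open>2 ^ C\<close>.\<close>
    then obtain x y where "x \<in> A" "y \<in> B" by auto
    then obtain C' where C: "C = Suc C'" using AliceSends.prems[of x y] by (cases C) auto
    let ?A1 = "{x \<in> A. f (eA x)}" and ?A2 = "{x \<in> A. \<not> f (eA x)}"
    have split: "?h (AliceSends f l r) A B = (\<lambda>x y. ?h l ?A1 B x y + ?h r ?A2 B x y)"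
      by (intro ext) (auto simp: indicator_def)
    have "real (card I) / 6 * disj_sum I (?h l ?A1 B) - uint_sum I (?h l ?A1 B) \<le> 2 ^ C' * ?\<tau>"
      by (rule AliceSends.IH(1)) (use AliceSends.prems C in fastforce)
    moreover have "real (card I) / 6 * disj_sum I (?h r ?A2 B) - uint_sum I (?h r ?A2 B) \<le> 2 ^ C' * ?\<tau>"
      by (rule AliceSends.IH(2)) (use AliceSends.prems C in fastforce)
    ultimately show ?thesis
      unfolding split disj_sum_add uint_sum_add C by (simp add: distrib_left)
  qed
next
  case (BobSends g l r)
  let ?\<tau> = "real (card I) * 4 ^ card I * exp (- real (card I) / 320000)"
  let ?h = "\<lambda>p A B x y. indicator A x * indicator B y * of_bool (Q (run p (eA x) (eB y))) :: real"
  show ?case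
  proof (cases "A = {} \<or> B = {}")
    case True
    then show ?thesis by (auto simp: disj_sum_def uint_sum_def)
  next
    case False
    then obtain x y where "x \<in> A" "y \<in> B" by auto
    then obtain C' where C: "C = Suc C'" using BobSends.prems[of x y] by (cases C) auto
    let ?B1 = "{y \<in> B. g (eB y)}" and ?B2 = "{y \<in> B. \<not> g (eB y)}"
    have split: "?h (BobSends g l r) A B = (\<lambda>x y. ?h l A ?B1 x y + ?h r A ?B2 x y)"
      by (intro ext) (auto simp: indicator_def)
    have "real (card I) / 6 * disj_sum I (?h l A ?B1) - uint_sum I (?h l A ?B1) \<le> 2 ^ C' * ?\<tau>"
      by (rule BobSends.IH(1)) (use BobSends.prems C in fastforce)
    moreover have "real (card I) / 6 * disj_sum I (?h r A ?B2) - uint_sum I (?h r A ?B2) \<le> 2 ^ C' * ?\<tau>"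
      by (rule BobSends.IH(2)) (use BobSends.prems C in fastforce)
    ultimately show ?thesis
      unfolding split disj_sum_add uint_sum_add C by (simp add: distrib_left)
  qed
qed

lemma expectation_disj_sum:
  fixes P :: "'p pmf"
  assumes "\<And>x y. integrable (measure_pmf P) (\<lambda>p. h p x y)"
  shows "integrable (measure_pmf P) (\<lambda>p. disj_sum I (h p))"
    and "measure_pmf.expectation P (\<lambda>p. disj_sum I (h p))
      = disj_sum I (\<lambda>x y. measure_pmf.expectation P (\<lambda>p. h p x y))"
  unfolding disj_sum_def by (simp_all add: assms)

lemma expectation_uint_sum:
  fixes P :: "'p pmf"
  assumes "\<And>x y. integrable (measure_pmf P) (\<lambda>p. h p x y)"
  shows "integrable (measure_pmf P) (\<lambda>p. uint_sum I (h p))"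
    and "measure_pmf.expectation P (\<lambda>p. uint_sum I (h p))
      = uint_sum I (\<lambda>x y. measure_pmf.expectation P (\<lambda>p. h p x y))"
  unfolding uint_sum_def by (simp_all add: assms)

text \<open>The corruption inequality is linear, so it survives the expectation over protocols. In
  units of \<open>real (card I) * 4 ^ card I\<close>, disjoint pairs give at least 1/6 * 2/3 = 1/9
  and uniquely intersecting ones at most 1/3 * 1/4 = 1/12; the gap is 1/36.\<close>

theorem randomized_unique_disjointness:
  fixes P :: "('x, 'y, 'o) prot pmf" and I :: "'a set"
  assumes "finite I" "I \<noteq> {}"
    and cost: "\<And>p x y. p \<in> set_pmf P \<Longrightarrow> x \<subseteq> I \<Longrightarrow> y \<subseteq> I \<Longrightarrow> comm p (eA x) (eB y) \<le> C"
    and disj: "\<And>x y. x \<subseteq> I \<Longrightarrow> y \<subseteq> I \<Longrightarrow> x \<inter> y = {} \<Longrightarrow>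
      2/3 \<le> measure_pmf.prob P {p. Q (run p (eA x) (eB y))}"
    and uint: "\<And>x y i. x \<subseteq> I \<Longrightarrow> y \<subseteq> I \<Longrightarrow> x \<inter> y = {i} \<Longrightarrow>
      measure_pmf.prob P {p. Q (run p (eA x) (eB y))} \<le> 1/3"
  shows "1/36 \<le> 2 ^ C * exp (- real (card I) / 320000)"
proof -
  define h where "h = (\<lambda>p x y. indicator (Pow I) x * indicator (Pow I) y
    * of_bool (Q (run p (eA x) (eB y))) :: real)"
  define pr where "pr = (\<lambda>x y. measure_pmf.expectation P (\<lambda>p. h p x y))"
  let ?N = "real (card I)" and ?\<theta> = "exp (- real (card I) / 320000)"
  have int: "integrable (measure_pmf P) (\<lambda>p. h p x y)" for x y
    by (rule measure_pmf.integrable_const_bound[where B = 1]) (auto simp: h_def indicator_def)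
  have pr: "pr x y = measure_pmf.prob P {p. Q (run p (eA x) (eB y))}" if "x \<subseteq> I" "y \<subseteq> I" for x y
  proof -
    have "pr x y = measure_pmf.expectation P (indicator {p. Q (run p (eA x) (eB y))})"
      unfolding pr_def h_def using that by (intro Bochner_Integration.integral_cong) auto
    then show ?thesis by simp
  qed
  have "?N / 6 * disj_sum I pr - uint_sum I pr
    = measure_pmf.expectation P (\<lambda>p. ?N / 6 * disj_sum I (h p) - uint_sum I (h p))"
    unfolding pr_def
    using expectation_disj_sum[OF int, of I] expectation_uint_sum[OF int, of I] by simp
  also have "\<dots> \<le> measure_pmf.expectation P (\<lambda>p. 2 ^ C * (?N * 4 ^ card I * ?\<theta>))"
  proof (rule integral_mono_AE)
    show "AE p in measure_pmf P. ?N / 6 * disj_sum I (h p) - uint_sum I (h p)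
      \<le> 2 ^ C * (?N * 4 ^ card I * ?\<theta>)"
      unfolding h_def by (rule AE_pmfI) (rule protocol_corruption, use assms(1) cost in auto)
  qed (use expectation_disj_sum[OF int, of I] expectation_uint_sum[OF int, of I] in auto)
  finally have ub: "?N / 6 * disj_sum I pr - uint_sum I pr \<le> 2 ^ C * (?N * 4 ^ card I * ?\<theta>)"
    by simp
  have "2/3 * 4 ^ card I = disj_sum I (\<lambda>x y. 2/3)" by (simp add: disj_sum_const assms(1))
  also have "\<dots> \<le> disj_sum I pr"
    unfolding disj_sum_def
  proof (intro sum_mono)
    fix V x y assume "V \<in> Pow I" "x \<in> Pow V" "y \<in> Pow (I - V)"
    then have "x \<subseteq> I" "y \<subseteq> I" "x \<inter> y = {}" by auto
    then show "2/3 \<le> pr x y" using disj pr by simp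
  qed
  finally have D: "?N / 6 * (2/3 * 4 ^ card I) \<le> ?N / 6 * disj_sum I pr"
    by (rule mult_left_mono) simp
  have "uint_sum I pr \<le> uint_sum I (\<lambda>x y. 1/3)"
    unfolding uint_sum_def
  proof (intro sum_mono)
    fix i T x y assume "i \<in> I" "T \<in> Pow (I - {i})" "x \<in> Pow T" "y \<in> Pow (I - {i} - T)"
    then have "insert i x \<subseteq> I" "insert i y \<subseteq> I" "insert i x \<inter> insert i y = {i}" by auto
    then show "pr (insert i x) (insert i y) \<le> 1/3" using uint pr by simp
  qed
  also have "\<dots> = 1/12 * ?N * 4 ^ card I" using uint_sum_const[OF assms(1), of "1/3"] by simp
  finally have "?N / 6 * (2/3 * 4 ^ card I) - 1/12 * ?N * 4 ^ card I
    \<le> 2 ^ C * (?N * 4 ^ card I * ?\<theta>)" using D ub by linarith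
  then have "(?N * 4 ^ card I) * (1/36) \<le> (?N * 4 ^ card I) * (2 ^ C * ?\<theta>)"
    by (simp add: field_simps)
  moreover have "0 < ?N * 4 ^ card I" using assms by (simp add: card_gt_0_iff)
  ultimately show ?thesis by (rule mult_left_le_imp_le)
qed

section \<open>The market\<close>

text \<open>Only tiers are specified; \<open>sort_key\<close> is stable and breaks ties by
  index.\<close>

definition list_by :: "nat \<Rightarrow> (nat \<Rightarrow> nat) \<Rightarrow> nat list" where
  "list_by n r = sort_key r [0..<n]"

definition profile_by :: "nat \<Rightarrow> (nat \<Rightarrow> nat \<Rightarrow> nat) \<Rightarrow> nat list list" where
  "profile_by n r = map (\<lambda>a. list_by n (r a)) [0..<n]"

definition marriage :: "nat \<Rightarrow> (nat \<Rightarrow> nat) \<Rightarrow> (nat \<times> nat) set" where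
  "marriage n \<sigma> = {(w, \<sigma> w) | w. w < n}"

lemma profile_profile_by: "profile n (profile_by n r)"
  by (auto simp: profile_def profile_by_def pref_list_def list_by_def)

lemma prefers_list_by_imp:
  assumes "prefers (list_by n r) a b"
  shows "r a \<le> r b" "a \<noteq> b"
proof -
  obtain i j where ij: "i < j" "j < length (list_by n r)" "list_by n r ! i = a" "list_by n r ! j = b"
    using assms unfolding prefers_def by auto
  have "sorted (map r (list_by n r))" unfolding list_by_def by (rule sorted_sort_key)
  from sorted_nth_mono[OF this, of i j] show "r a \<le> r b" using ij by auto
  have "distinct (list_by n r)" unfolding list_by_def by simp
  then show "a \<noteq> b" using ij by (auto simp: nth_eq_iff_index_eq)
qed

lemma prefers_list_by_less:
  assumes "a < n" "b < n" "r a < r b"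
  shows "prefers (list_by n r) a b"
proof -
  have "a \<in> set (list_by n r)" "b \<in> set (list_by n r)" using assms by (auto simp: list_by_def)
  then obtain i j where ij: "i < length (list_by n r)" "j < length (list_by n r)"
    "list_by n r ! i = a" "list_by n r ! j = b" by (metis in_set_conv_nth)
  have "sorted (map r (list_by n r))" unfolding list_by_def by (rule sorted_sort_key)
  from sorted_nth_mono[OF this, of j i] have "i < j" using ij assms(3) by (auto simp: not_less[symmetric])
  then show ?thesis unfolding prefers_def using ij by auto
qed

lemma perfect_marriage_iff:
  "perfect_marriage n \<mu> \<longleftrightarrow> (\<exists>\<sigma>. bij_betw \<sigma> {..<n} {..<n} \<and> \<mu> = marriage n \<sigma>)"
proof
  assume \<mu>: "perfect_marriage n \<mu>"
  define \<sigma> where "\<sigma> w = (THE m. (w, m) \<in> \<mu>)" for w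
  have \<sigma>: "(w, m) \<in> \<mu> \<longleftrightarrow> m = \<sigma> w" if "w < n" for w m
    using \<mu> that theI'[of "\<lambda>m. (w, m) \<in> \<mu>"] unfolding perfect_marriage_def \<sigma>_def by blast
  have sub: "\<mu> \<subseteq> {..<n} \<times> {..<n}" using \<mu> unfolding perfect_marriage_def by auto
  have "inj_on \<sigma> {..<n}"
  proof (rule inj_onI)
    fix v w assume "v \<in> {..<n}" "w \<in> {..<n}" "\<sigma> v = \<sigma> w"
    then have "(v, \<sigma> v) \<in> \<mu>" "(w, \<sigma> v) \<in> \<mu>" using \<sigma> by auto
    then show "v = w" using \<mu> sub unfolding perfect_marriage_def by blast
  qed
  moreover have "\<sigma> ` {..<n} \<subseteq> {..<n}" using \<sigma> sub by fastforce
  ultimately have "bij_betw \<sigma> {..<n} {..<n}" by (simp add: bij_betw_def endo_inj_surj)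
  moreover have "\<mu> = marriage n \<sigma>" unfolding marriage_def using \<sigma> sub by auto
  ultimately show "\<exists>\<sigma>. bij_betw \<sigma> {..<n} {..<n} \<and> \<mu> = marriage n \<sigma>" by blast
next
  assume "\<exists>\<sigma>. bij_betw \<sigma> {..<n} {..<n} \<and> \<mu> = marriage n \<sigma>"
  then obtain \<sigma> where \<sigma>: "inj_on \<sigma> {..<n}" "\<sigma> ` {..<n} = {..<n}" and \<mu>: "\<mu> = marriage n \<sigma>"
    by (auto simp: bij_betw_def)
  have "\<exists>!w. (w, m) \<in> \<mu>" if "m < n" for m
  proof -
    have "m \<in> \<sigma> ` {..<n}" using that \<sigma> by auto
    then obtain w where "w < n" "m = \<sigma> w" by auto
    then show ?thesis using \<sigma>(1) by (auto simp: \<mu> marriage_def inj_on_def)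
  qed
  moreover have "\<mu> \<subseteq> {..<n} \<times> {..<n}" using \<sigma>(2) by (auto simp: \<mu> marriage_def)
  ultimately show "perfect_marriage n \<mu>"
    by (auto simp: perfect_marriage_def \<mu> marriage_def)
qed

lemma stable_marriage_rank:
  assumes "stable n (profile_by n rW) (profile_by n rM) (marriage n \<sigma>)"
    and "bij_betw \<sigma> {..<n} {..<n}" "w < n" "v < n"
  shows "rW w (\<sigma> w) \<le> rW w (\<sigma> v) \<or> rM (\<sigma> v) v \<le> rM (\<sigma> v) w"
proof (rule ccontr)
  assume "\<not> ?thesis"
  then have less: "rW w (\<sigma> v) < rW w (\<sigma> w)" "rM (\<sigma> v) w < rM (\<sigma> v) v" by auto
  have \<sigma>: "\<sigma> v < n" "\<sigma> w < n" using assms by (auto simp: bij_betw_def)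
  then have "blocking (profile_by n rW) (profile_by n rM) (marriage n \<sigma>) w (\<sigma> v)"
    unfolding blocking_def profile_by_def marriage_def
    using assms(3,4) less by (auto intro!: prefers_list_by_less)
  then show False using assms(1) unfolding stable_def by auto
qed

text \<open>Excluding even the pairs that are merely tied in tier gives stability for every tie
  breaking.\<close>

lemma stable_marriageI:
  assumes bij: "bij_betw \<sigma> {..<n} {..<n}"
    and rank: "\<And>w v. w < n \<Longrightarrow> v < n \<Longrightarrow> w \<noteq> v \<Longrightarrow> rW w (\<sigma> v) \<le> rW w (\<sigma> w) \<Longrightarrow>
      rM (\<sigma> v) w \<le> rM (\<sigma> v) v \<Longrightarrow> False"
  shows "stable n (profile_by n rW) (profile_by n rM) (marriage n \<sigma>)"
proof -
  have "\<not> blocking (profile_by n rW) (profile_by n rM) (marriage n \<sigma>) w m" for w m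
  proof
    assume "blocking (profile_by n rW) (profile_by n rM) (marriage n \<sigma>) w m"
    then obtain v where v: "w < n" "v < n" "m = \<sigma> v"
      "prefers (profile_by n rW ! w) m (\<sigma> w)" "prefers (profile_by n rM ! m) w v"
      unfolding blocking_def marriage_def by auto
    have "\<sigma> v < n" using v bij by (auto simp: bij_betw_def)
    then have "prefers (list_by n (rW w)) (\<sigma> v) (\<sigma> w)" "prefers (list_by n (rM (\<sigma> v))) w v"
      using v by (auto simp: profile_by_def)
    from prefers_list_by_imp[OF this(1)] prefers_list_by_imp[OF this(2)] rank v
    show False by blast
  qed
  then show ?thesis unfolding stable_def perfect_marriage_iff using bij by auto
qed

section \<open>The hard market and its two candidate marriages\<close>

text \<open>The hard market, as preference tiers (0 is best). Agents \<open>< k\<close> and \<open>k..<2*k\<close> of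
  either side carry the disjointness instance, agents \<open>2*k..<n\<close> form a chain. The identity
  is stable unless some pair \<open>(i, j) \<in> x \<inter> y\<close> makes woman \<open>i\<close> elope with man \<open>k + j\<close>; then
  man \<open>i\<close> displaces man \<open>2*k\<close> at woman \<open>2*k\<close>, who displaces the next man, and so on until man
  \<open>n - 1\<close> ends up with the abandoned woman \<open>k + j\<close>.\<close>

definition rank_W :: "nat \<Rightarrow> nat \<Rightarrow> (nat \<times> nat) set \<Rightarrow> nat \<Rightarrow> nat \<Rightarrow> nat" where
  "rank_W n k x w m =
    (if w < k then if k \<le> m \<and> m < 2 * k \<and> (w, m - k) \<in> x then 0 else if m = w then 1 else 2
     else if w < 2 * k then if m = w then 0 else if m = n - 1 then 1 else 2
     else if w = 2 * k then if m < k then 0 else if m = w then 1 else 2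
     else if Suc m = w then 0 else if m = w then 1 else 2)"

definition rank_M :: "nat \<Rightarrow> (nat \<times> nat) set \<Rightarrow> nat \<Rightarrow> nat \<Rightarrow> nat" where
  "rank_M k y m w =
    (if m < k then if w = m then 0 else if w = 2 * k then 1 else 2
     else if m < 2 * k then if w < k \<and> (w, m - k) \<in> y then 0 else if w = m then 1 else 2
     else if w = m then 0 else if w = Suc m then 1 else 2)"

text \<open>End state of the displacements. For \<open>i < k\<close>, every woman from
  \<open>2 * k\<close> on changes her husband, so agreement with the identity is confined to the
  first \<open>2 * k\<close> women.\<close>

definition shifted :: "nat \<Rightarrow> nat \<Rightarrow> nat \<Rightarrow> nat \<Rightarrow> nat \<Rightarrow> nat" where
  "shifted n k i j w =
    (if w = i then k + j else if w = k + j then n - 1 else if w = 2 * k then i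
     else if 2 * k < w then w - 1 else w)"

lemma bij_shifted:
  assumes "2 * k < n" "i < k" "j < k"
  shows "bij_betw (shifted n k i j) {..<n} {..<n}"
proof -
  have "inj_on (shifted n k i j) {..<n}"
    using assms by (auto simp: inj_on_def shifted_def split: if_splits)
  moreover have "shifted n k i j ` {..<n} \<subseteq> {..<n}"
    using assms by (auto simp: shifted_def)
  ultimately show ?thesis by (simp add: bij_betw_def endo_inj_surj)
qed

lemma rank_W_le:
  "w < k \<Longrightarrow> rank_W n k x w m \<le> 0 \<longleftrightarrow> k \<le> m \<and> m < 2 * k \<and> (w, m - k) \<in> x"
  "w < k \<Longrightarrow> rank_W n k x w m \<le> 1 \<longleftrightarrow> m = w \<or> k \<le> m \<and> m < 2 * k \<and> (w, m - k) \<in> x"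
  "k \<le> w \<Longrightarrow> w < 2 * k \<Longrightarrow> rank_W n k x w m \<le> 0 \<longleftrightarrow> m = w"
  "k \<le> w \<Longrightarrow> w < 2 * k \<Longrightarrow> rank_W n k x w m \<le> 1 \<longleftrightarrow> m = w \<or> m = n - 1"
  "0 < k \<Longrightarrow> rank_W n k x (2 * k) m \<le> 0 \<longleftrightarrow> m < k"
  "0 < k \<Longrightarrow> rank_W n k x (2 * k) m \<le> 1 \<longleftrightarrow> m < k \<or> m = 2 * k"
  "2 * k < w \<Longrightarrow> rank_W n k x w m \<le> 0 \<longleftrightarrow> Suc m = w"
  "2 * k < w \<Longrightarrow> rank_W n k x w m \<le> 1 \<longleftrightarrow> Suc m = w \<or> m = w"
  by (simp_all add: rank_W_def)

lemma rank_M_le: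
  "m < k \<Longrightarrow> rank_M k y m w \<le> 0 \<longleftrightarrow> w = m"
  "m < k \<Longrightarrow> rank_M k y m w \<le> 1 \<longleftrightarrow> w = m \<or> w = 2 * k"
  "k \<le> m \<Longrightarrow> m < 2 * k \<Longrightarrow> rank_M k y m w \<le> 0 \<longleftrightarrow> w < k \<and> (w, m - k) \<in> y"
  "k \<le> m \<Longrightarrow> m < 2 * k \<Longrightarrow> rank_M k y m w \<le> 1 \<longleftrightarrow> w = m \<or> w < k \<and> (w, m - k) \<in> y"
  "2 * k \<le> m \<Longrightarrow> rank_M k y m w \<le> 0 \<longleftrightarrow> w = m"
  "2 * k \<le> m \<Longrightarrow> rank_M k y m w \<le> 1 \<longleftrightarrow> w = m \<or> w = Suc m"
  by (simp_all add: rank_M_def)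

text \<open>A low woman and a middle man block only through a pair in \<open>x \<inter> y\<close>.
  Middle women have their first choice, and whoever a chain woman prefers has his.\<close>

lemma stable_identity:
  assumes "0 < k" "x \<inter> y = {}"
  shows "stable n (profile_by n (rank_W n k x)) (profile_by n (rank_M k y)) (marriage n (\<lambda>w. w))"
proof (rule stable_marriageI)
  show "bij_betw (\<lambda>w. w) {..<n} {..<n}" by (simp add: bij_betw_def)
  fix w v
  assume ne: "w \<noteq> v" and W: "rank_W n k x w v \<le> rank_W n k x w w"
    and M: "rank_M k y v w \<le> rank_M k y v v"
  have W': "rank_W n k x w v \<le> c" if "rank_W n k x w w \<le> c" for c using W that by linarith
  have M': "rank_M k y v w \<le> c" if "rank_M k y v v \<le> c" for c using M that by linarith
  consider "w < k" | "k \<le> w" "w < 2 * k" | "w = 2 * k" | "2 * k < w" by linarith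
  then show False
  proof cases
    case 1
    then have "k \<le> v" "v < 2 * k" "(w, v - k) \<in> x" using W'[of 1] rank_W_le(2)[of w] ne by auto
    moreover from this have "(w, v - k) \<in> y" using M'[of 1] rank_M_le(4)[of k v] ne by auto
    ultimately show False using assms by auto
  next
    case 2
    then show False using W'[of 0] rank_W_le(3)[of k w] ne by auto
  next
    case 3
    then have "v < k" using W'[of 1] rank_W_le(6) assms ne by auto
    then show False using M'[of 0] rank_M_le(1)[of v] ne by auto
  next
    case 4
    then have "Suc v = w" using W'[of 1] rank_W_le(8)[of k w] ne by auto
    then show False using M'[of 0] rank_M_le(5)[of k v] 4 ne by auto
  qed
qed

text \<open>A blocking pair of a low woman with a middle man would need a second element of
  \<open>x \<inter> y\<close>. Woman \<open>k + j\<close> wants man \<open>k + j\<close>, who has a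
  tier 0 wife; the low men tied with \<open>i\<close> for woman \<open>2 * k\<close> have their
  first choice; the remaining women have theirs.\<close>

lemma stable_shifted:
  assumes "2 * k < n" "i < k" "j < k" "x \<inter> y = {(i, j)}"
  shows "stable n (profile_by n (rank_W n k x)) (profile_by n (rank_M k y))
    (marriage n (shifted n k i j))"
proof (rule stable_marriageI[OF bij_shifted[OF assms(1-3)]])
  define s where "s = shifted n k i j"
  fix w v
  assume n: "w < n" "v < n" and ne: "w \<noteq> v"
    and "rank_W n k x w (shifted n k i j v) \<le> rank_W n k x w (shifted n k i j w)"
    and "rank_M k y (shifted n k i j v) w \<le> rank_M k y (shifted n k i j v) v"
  then have W: "rank_W n k x w (s v) \<le> rank_W n k x w (s w)"
    and M: "rank_M k y (s v) w \<le> rank_M k y (s v) v" unfolding s_def by auto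
  have W': "rank_W n k x w (s v) \<le> c" if "rank_W n k x w (s w) \<le> c" for c using W that by linarith
  have M': "rank_M k y (s v) w \<le> c" if "rank_M k y (s v) v \<le> c" for c using M that by linarith
  have xy: "(i, j) \<in> x" "(i, j) \<in> y" "\<And>a b. (a, b) \<in> x \<Longrightarrow> (a, b) \<in> y \<Longrightarrow> a = i \<and> b = j"
    using assms(4) by auto
  have ne': "s w \<noteq> s v"
    using bij_shifted[OF assms(1-3)] n ne by (auto simp: bij_betw_def inj_on_def s_def)
  have si: "s i = k + j" by (simp add: s_def shifted_def)
  have s1: "s a = a" if "a < k" "a \<noteq> i" for a using that by (simp add: s_def shifted_def)
  have sj: "s (k + j) = n - 1" using assms by (simp add: s_def shifted_def)
  have s2: "s a = a" if "k \<le> a" "a < 2 * k" "a \<noteq> k + j" for a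
    using that assms by (simp add: s_def shifted_def)
  have s3: "s (2 * k) = i" using assms by (simp add: s_def shifted_def)
  have s4: "s a = a - 1" if "2 * k < a" for a using that assms by (simp add: s_def shifted_def)
  \<comment> \<open>Every middle man is married to woman \<open>i\<close> or to his own
    counterpart.\<close>
  have inv: "v = i \<or> s v = v" if "k \<le> s v" "s v < 2 * k"
  proof -
    consider "v < k" | "k \<le> v" "v < 2 * k" "v \<noteq> k + j" | "v = k + j" | "v = 2 * k" | "2 * k < v"
      by linarith
    then show ?thesis
    proof cases
      case 1
      then show ?thesis using s1 by blast
    next
      case 2
      then show ?thesis using s2 by blast
    next
      case 3
      then show ?thesis using sj that assms by simp
    next
      case 4
      then show ?thesis using s3 that assms by simp
    next
      case 5
      then show ?thesis using s4[OF 5] that by simp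
    qed
  qed
  consider "w < k" "w \<noteq> i" | "w = i" | "k \<le> w" "w < 2 * k" "w \<noteq> k + j" | "w = k + j"
    | "w = 2 * k" | "2 * k < w" by linarith
  then show False
  proof cases
    case 1
    have sw: "s w = w" using 1 by (rule s1)
    have sv: "k \<le> s v" "s v < 2 * k" "(w, s v - k) \<in> x"
      using W'[of 1] ne' unfolding sw rank_W_le(2)[OF 1(1)] by auto
    have "(w, s v - k) \<in> y"
    proof (cases "v = i")
      case True
      then show ?thesis using M'[of 0] xy(2) si assms(2) unfolding rank_M_le(3)[OF sv(1,2)] by simp
    next
      case False
      then show ?thesis using M'[of 1] ne inv[OF sv(1,2)] unfolding rank_M_le(4)[OF sv(1,2)] by simp
    qed
    then show False using xy(3) sv 1 by blast
  next
    case 2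
    have sv: "k \<le> s v" "s v < 2 * k" "(w, s v - k) \<in> x"
      using W'[of 0] xy(1) si assms unfolding 2 rank_W_le(1)[OF assms(2)] by auto
    have "(w, s v - k) \<in> y"
      using M'[of 1] ne inv[OF sv(1,2)] 2 unfolding rank_M_le(4)[OF sv(1,2)] by simp
    then have "s v - k = j" using xy(3)[OF sv(3)] by blast
    then have "s v = k + j" using sv(1) by arith
    then show False using ne' si 2 by simp
  next
    case 3
    then show False using W'[of 0] ne' unfolding s2[OF 3] rank_W_le(3)[OF 3(1,2)] by simp
  next
    case 4
    have kj: "k \<le> k + j" "k + j < 2 * k" using assms by auto
    have sv: "s v = k + j" using W'[of 1] ne' unfolding 4 sj rank_W_le(4)[OF kj] by simp
    then have vi: "v = i" using inv kj ne 4 by auto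
    show False using M'[of 0] xy(2) assms(2) unfolding vi 4 si rank_M_le(3)[OF kj] by simp
  next
    case 5
    have k0: "0 < k" using assms by simp
    have sv: "s v < k" using W'[of 0] assms(2) unfolding 5 rank_W_le(5)[OF k0] s3 by simp
    have "s v = v"
    proof (cases "v < k")
      case True
      then show ?thesis using s1 si sv by (cases "v = i") auto
    next
      case False
      then show ?thesis using s2[of v] sj s4[of v] sv 5 ne assms
        by (cases "v = k + j"; cases "v < 2 * k") auto
    qed
    then show False using M'[of 0] ne unfolding rank_M_le(1)[OF sv] by simp
  next
    case 6
    then have "s v = w - 1" using W'[of 0] unfolding rank_W_le(7)[OF 6] s4[OF 6] by auto
    then show False using ne' s4[OF 6] by simp
  qed
qed

section \<open>Uniqueness of the stable marriage\<close>

text \<open>\<open>ranked_stable\<close> only excludes blocking pairs that are strict in both tier functions,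
  so it holds for every tie breaking.\<close>

locale ranked_stable =
  fixes n k :: nat and x y :: "(nat \<times> nat) set" and \<sigma> :: "nat \<Rightarrow> nat"
  assumes k: "0 < k" "2 * k < n"
    and bij: "bij_betw \<sigma> {..<n} {..<n}"
    and noblock: "w < n \<Longrightarrow> v < n \<Longrightarrow>
      rank_W n k x w (\<sigma> w) \<le> rank_W n k x w (\<sigma> v) \<or> rank_M k y (\<sigma> v) v \<le> rank_M k y (\<sigma> v) w"
begin

lemma inj: "w < n \<Longrightarrow> v < n \<Longrightarrow> \<sigma> w = \<sigma> v \<Longrightarrow> w = v"
  using bij by (auto simp: bij_betw_def inj_on_def)

text \<open>The test behind all forced moves: were both spouses worse than the levels
  \<open>a\<close> and \<open>b\<close>, the pair would block strictly.\<close>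

lemma nonblocking:
  assumes "w < n" "m < n" "rank_W n k x w m \<le> a" "rank_M k y m w \<le> b"
  obtains "rank_W n k x w (\<sigma> w) \<le> a" | v where "v < n" "\<sigma> v = m" "rank_M k y m v \<le> b"
proof -
  have "m \<in> \<sigma> ` {..<n}" using bij assms by (auto simp: bij_betw_def)
  then obtain v where "v < n" "\<sigma> v = m" by auto
  then show thesis using noblock[OF assms(1), of v] assms(3,4) that by fastforce
qed

lemma woman_low:
  assumes "i < k"
  shows "\<sigma> i = i \<or> k \<le> \<sigma> i \<and> \<sigma> i < 2 * k \<and> (i, \<sigma> i - k) \<in> x"
proof -
  have i: "i < n" using assms k by linarith
  show ?thesis
    by (rule nonblocking[OF i i, of 1 0])
      (auto simp only: rank_W_le(2)[OF assms] rank_M_le(1)[OF assms])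
qed

text \<open>If she misses her first choice, her man must hold a low woman that \<open>y\<close>
  ranks first for him, and \<open>woman_low\<close> puts the same pair into
  \<open>x\<close>.\<close>

lemma woman_mid:
  assumes "j < k"
  shows "\<sigma> (k + j) = k + j \<or> (\<exists>i<k. \<sigma> i = k + j \<and> (i, j) \<in> x \<inter> y)"
proof -
  have w: "k + j < n" "k \<le> k + j" "k + j < 2 * k" using assms k by linarith+
  show ?thesis
  proof (rule nonblocking[OF w(1) w(1), of 0 1])
    fix v assume v: "\<sigma> v = k + j" "rank_M k y (k + j) v \<le> 1"
    then have "v = k + j \<or> v < k \<and> (v, j) \<in> y" using rank_M_le(4)[OF w(2,3)] by auto
    moreover have "(v, j) \<in> x" if "v < k" using woman_low[OF that] v that by auto
    ultimately show ?thesis using v by blast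
  qed (auto simp only: rank_W_le(3)[OF w(2,3)] rank_M_le(4)[OF w(2,3)])
qed

lemma chain_head: "\<sigma> (2 * k) < k \<or> \<sigma> (2 * k) = 2 * k"
  by (rule nonblocking[OF k(2) k(2), of 1 0])
    (auto simp only: rank_W_le(6)[OF k(1)] rank_M_le(5)[OF order_refl])

lemma chain_tail:
  assumes "2 * k < w" "w < n"
  shows "Suc (\<sigma> w) = w \<or> \<sigma> w = w"
  by (rule nonblocking[OF assms(2,2), of 1 0])
    (auto simp only: rank_W_le(8)[OF assms(1)] rank_M_le(5)[OF less_imp_le[OF assms(1)]])

text \<open>The order matters: middle women keep their partners, so low women find all middle men
  taken, then woman \<open>2 * k\<close> finds all low men taken, and the chain follows by
  induction.\<close>

lemma disjoint_imp_identity: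
  assumes "x \<inter> y = {}" "w < n"
  shows "\<sigma> w = w"
proof -
  have mid: "\<sigma> w = w" if "k \<le> w" "w < 2 * k" for w
    using woman_mid[of "w - k"] that assms(1) by auto
  have low: "\<sigma> w = w" if "w < k" for w
    using woman_low[OF that] mid[of "\<sigma> w"] inj[of w "\<sigma> w"] that k by auto
  have chain: "2 * k + t < n \<Longrightarrow> \<sigma> (2 * k + t) = 2 * k + t" for t
  proof (induction t)
    case 0
    then show ?case using chain_head low[of "\<sigma> (2 * k)"] inj[of "2 * k" "\<sigma> (2 * k)"] k by auto
  next
    case (Suc t)
    then show ?case using chain_tail[of "2 * k + Suc t"] inj[of "2 * k + Suc t" "2 * k + t"] by auto
  qed
  show ?thesis
    using low[of w] mid[of w] chain[of "w - 2 * k"] assms(2)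
    by (cases "w < k"; cases "w < 2 * k") auto
qed

lemma unique_intersection_imp_shifted:
  assumes xy: "x \<inter> y = {(i, j)}" and ij: "i < k" "j < k" and "w < n"
  shows "\<sigma> w = shifted n k i j w"
proof -
  have inx: "(i, j) \<in> x" and iny: "(i, j) \<in> y" using xy by auto
  have w: "i < n" "k + j < n" "k \<le> k + j" "k + j < 2 * k" using ij k by linarith+
  have mid: "\<sigma> w = w" if "k \<le> w" "w < 2 * k" "w \<noteq> k + j" for w
  proof -
    have "w - k < k" "k + (w - k) = w" "w - k \<noteq> j" using that by arith+
    then show ?thesis using woman_mid[of "w - k"] xy by auto
  qed
  \<comment> \<open>Otherwise man \<open>k + j\<close> is with woman \<open>k + j\<close> and wants
    woman \<open>i\<close>; she declines only for another tier 0 man, and each of those is with his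
    own counterpart.\<close>
  have i: "\<sigma> i = k + j"
  proof (rule ccontr)
    assume ne: "\<sigma> i \<noteq> k + j"
    then have kj: "\<sigma> (k + j) = k + j" using woman_mid[OF ij(2)] xy by auto
    show False
    proof (rule nonblocking[OF w(1,2), of 0 0])
      assume "rank_W n k x i (\<sigma> i) \<le> 0"
      then have "k \<le> \<sigma> i" "\<sigma> i < 2 * k" using rank_W_le(1)[OF ij(1)] by auto
      then show False using mid[of "\<sigma> i"] ne inj[of i "\<sigma> i"] ij k by auto
    next
      fix v assume v: "v < n" "\<sigma> v = k + j" "rank_M k y (k + j) v \<le> 0"
      moreover have "v = k + j" using inj[OF v(1) w(2)] v(2) kj by simp
      ultimately show False using rank_M_le(3)[OF w(3,4)] by simp
    qed (use inx iny ij rank_W_le(1)[OF ij(1)] rank_M_le(3)[OF w(3,4)] in auto)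
  qed
  have low: "\<sigma> w = w" if "w < k" "w \<noteq> i" for w
  proof (rule ccontr)
    assume ne: "\<sigma> w \<noteq> w"
    then have *: "k \<le> \<sigma> w" "\<sigma> w < 2 * k" using woman_low[OF that(1)] by auto
    have "\<sigma> w \<noteq> k + j" using inj[of w i] i that k w by auto
    from mid[OF * this] show False using inj[of w "\<sigma> w"] ne * that k by auto
  qed
  \<comment> \<open>Man \<open>i\<close> has lost woman \<open>i\<close> and accepts woman
    \<open>2 * k\<close> next; she ranks low men first, and the others are taken.\<close>
  have head: "\<sigma> (2 * k) = i"
  proof (rule nonblocking[OF k(2) w(1), of 0 1])
    assume "rank_W n k x (2 * k) (\<sigma> (2 * k)) \<le> 0"
    then have "\<sigma> (2 * k) < k" by (simp only: rank_W_le(5)[OF k(1)])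
    then show ?thesis using low[of "\<sigma> (2 * k)"] inj[of "2 * k" "\<sigma> (2 * k)"] k by fastforce
  next
    fix v assume v: "\<sigma> v = i" "rank_M k y i v \<le> 1"
    then have "v = i \<or> v = 2 * k" using rank_M_le(2)[OF ij(1)] by blast
    then show ?thesis using v i ij by auto
  qed (use ij rank_W_le(5)[OF k(1)] rank_M_le(2)[OF ij(1)] in auto)
  \<comment> \<open>Each man who lost his own woman is the first choice of the next woman, and she
    is his second.\<close>
  have chain: "2 * k + Suc t < n \<Longrightarrow> \<sigma> (2 * k + Suc t) = 2 * k + t" for t
  proof (induction t)
    case 0
    have ne: "\<sigma> (2 * k) \<noteq> 2 * k" using head ij by simp
    show ?case
      by (rule nonblocking[OF 0 k(2), of 0 1])
        (use ne in \<open>auto simp: rank_W_def rank_M_def split: if_splits\<close>)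
  next
    case (Suc t)
    have n: "2 * k + Suc t < n" using Suc.prems by auto
    have ne: "\<sigma> (2 * k + Suc t) \<noteq> 2 * k + Suc t" using Suc.IH n by simp
    show ?case
      by (rule nonblocking[OF Suc.prems n, of 0 1])
        (use ne in \<open>auto simp: rank_W_def rank_M_def split: if_splits\<close>)
  qed
  have tail: "\<sigma> w = w - 1" if "2 * k < w" "w < n" for w
    using chain[of "w - 2 * k - 1"] that by simp
  \<comment> \<open>By surjectivity: all other women have husbands different from
    \<open>n - 1\<close>.\<close>
  have last: "\<sigma> (k + j) = n - 1"
  proof -
    have "n - 1 \<in> \<sigma> ` {..<n}" using bij k by (auto simp: bij_betw_def)
    then obtain v where v: "v < n" "\<sigma> v = n - 1" by auto
    have "\<not> v < k" using low[of v] i v w k by (cases "v = i") auto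
    moreover have "\<not> (v < 2 * k \<and> v \<noteq> k + j)" using mid[of v] calculation v k by force
    moreover have "\<not> 2 * k < v" using tail[of v] v by auto
    moreover have "v \<noteq> 2 * k" using head v ij k by auto
    ultimately have "v = k + j" by linarith
    then show ?thesis using v by simp
  qed
  show ?thesis
    using i low[of w] mid[of w] last head tail[of w] \<open>w < n\<close> ij unfolding shifted_def
    by (cases "w < k"; cases "w < 2 * k") auto
qed

end

lemma unique_stable:
  fixes n k :: nat and x y :: "(nat \<times> nat) set"
  assumes "0 < k" "2 * k < n" and sub: "x \<subseteq> {..<k} \<times> {..<k}"
  defines "PW \<equiv> profile_by n (rank_W n k x)" and "PM \<equiv> profile_by n (rank_M k y)"
  shows "x \<inter> y = {} \<Longrightarrow> stable n PW PM \<mu> \<longleftrightarrow> \<mu> = marriage n (\<lambda>w. w)"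
    and "x \<inter> y = {(i, j)} \<Longrightarrow> stable n PW PM \<mu> \<longleftrightarrow> \<mu> = marriage n (shifted n k i j)"
proof -
  have stab: "\<exists>\<sigma>. \<mu> = marriage n \<sigma> \<and> ranked_stable n k x y \<sigma>" if "stable n PW PM \<mu>"
  proof -
    obtain \<sigma> where \<sigma>: "bij_betw \<sigma> {..<n} {..<n}" "\<mu> = marriage n \<sigma>"
      using \<open>stable n PW PM \<mu>\<close> unfolding stable_def perfect_marriage_iff by auto
    then have "ranked_stable n k x y \<sigma>"
      using stable_marriage_rank[of n "rank_W n k x" "rank_M k y" \<sigma>] that assms(1,2)
      by unfold_locales (auto simp: PW_def PM_def)
    then show ?thesis using \<sigma> by auto
  qed
  have cong: "marriage n \<sigma> = marriage n \<tau>" if "\<And>w. w < n \<Longrightarrow> \<sigma> w = \<tau> w" for \<sigma> \<tau>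
    using that unfolding marriage_def by force
  show "stable n PW PM \<mu> \<longleftrightarrow> \<mu> = marriage n (\<lambda>w. w)" if "x \<inter> y = {}"
    using stab ranked_stable.disjoint_imp_identity[OF _ that] stable_identity[OF assms(1) that]
      cong unfolding PW_def PM_def by metis
  show "stable n PW PM \<mu> \<longleftrightarrow> \<mu> = marriage n (shifted n k i j)" if "x \<inter> y = {(i, j)}"
  proof -
    have ij: "i < k" "j < k" using that sub by auto
    show ?thesis
      using stab ranked_stable.unique_intersection_imp_shifted[OF _ that ij]
        stable_shifted[OF assms(2) ij that] cong unfolding PW_def PM_def by metis
  qed
qed

section \<open>The lower bound\<close>

lemma card_marriage: "card (marriage n \<sigma>) = n"
proof -
  have "marriage n \<sigma> = (\<lambda>w. (w, \<sigma> w)) ` {..<n}" unfolding marriage_def by auto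
  then show ?thesis by (simp add: card_image inj_on_def)
qed

lemma finite_marriage: "finite (marriage n \<sigma>)"
  unfolding marriage_def by simp

lemma good_output_marriage:
  assumes "\<And>p. G n PW PM p \<longleftrightarrow> p \<in> marriage n \<sigma>"
  shows "good_output G eps n PW PM S \<longleftrightarrow> S \<subseteq> marriage n \<sigma> \<and> eps * real n \<le> real (card S)"
proof -
  have "S \<subseteq> marriage n \<sigma> \<Longrightarrow> finite S" by (rule finite_subset[OF _ finite_marriage])
  then show ?thesis unfolding good_output_def assms by auto
qed

text \<open>With a unique stable marriage, "some" and "every" coincide; \<open>G\<close> stands for
  either task, so one reduction serves both.\<close>

lemma task_lower_bound:
  fixes G and eps :: real
  assumes eps: "0 < eps" "eps \<le> 1"
    and G: "\<And>n PW PM \<mu> p. (\<And>\<nu>. stable n PW PM \<nu> \<longleftrightarrow> \<nu> = \<mu>) \<Longrightarrow> G n PW PM p \<longleftrightarrow> p \<in> \<mu>"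
  shows "\<exists>c>0. \<exists>N. \<forall>n\<ge>N. \<forall>P. solves G eps n P \<longrightarrow> cost_at_least n P (c * real n ^ 2)"
proof -
  \<comment> \<open>40960000 = 64 * 2 * 320000: \<open>k \<ge> eps * n / 8\<close> gives the 64, and
    the 2 makes the error exponent twice the cost bound.\<close>
  define c where "c = eps\<^sup>2 / 40960000"
  have c: "0 < c" unfolding c_def using eps by simp
  \<comment> \<open>The first bound makes \<open>k\<close> positive with little rounding loss, the
    second makes exp (- c * n^2) at most 1/37.\<close>
  define N where "N = max (nat \<lceil>8 / eps\<rceil>) (nat \<lceil>36 / c\<rceil>)"
  have "cost_at_least n P (c * real n ^ 2)" if "N \<le> n" and P: "solves G eps n P" for n P
  proof (rule ccontr)
    assume cheap: "\<not> cost_at_least n P (c * real n ^ 2)"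
    have "8 / eps \<le> real n" "36 / c \<le> real n" using that(1) unfolding N_def by linarith+
    then have n: "8 \<le> eps * real n" "36 \<le> c * real n"
      using eps c by (simp_all add: field_simps)
    \<comment> \<open>Since \<open>eps * real n / 4\<close> is at least 2, rounding loses at most
      half; and \<open>2 * k\<close> stays within half of \<open>eps * real n\<close>.\<close>
    define k where "k = nat \<lfloor>eps * real n / 4\<rfloor>"
    have k: "real k \<le> eps * real n / 4" "eps * real n / 8 \<le> real k" "0 < k"
      unfolding k_def using n(1) by linarith+
    have "eps * real n \<le> 1 * real n" using eps by (intro mult_right_mono) auto
    then have kn: "2 * k < n" using k n by linarith
    define I where "I = {..<k} \<times> {..<k}"
    define Q where "Q S \<longleftrightarrow> S \<subseteq> marriage n (\<lambda>w. w) \<and> eps * real n \<le> real (card S)" for S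
    define C where "C = nat \<lfloor>c * real n ^ 2\<rfloor>"
    let ?PW = "\<lambda>x. profile_by n (rank_W n k x)" and ?PM = "\<lambda>y. profile_by n (rank_M k y)"
    have prob: "2/3 \<le> measure_pmf.prob P
        {p. run p (?PW x) (?PM y) \<subseteq> marriage n \<sigma> \<and> eps * real n \<le> real (card (run p (?PW x) (?PM y)))}"
      if "\<And>\<nu>. stable n (?PW x) (?PM y) \<nu> \<longleftrightarrow> \<nu> = marriage n \<sigma>" for x y \<sigma>
    proof -
      note good = good_output_marriage[of G n "?PW x" "?PM y" \<sigma> eps, OF G[OF that]]
      \<comment> \<open>The whole marriage is a valid answer, so the guarantee in
        \<open>solves\<close> applies.\<close>
      have "good_output G eps n (?PW x) (?PM y) (marriage n \<sigma>)"
        unfolding good using eps by (simp add: card_marriage mult_left_le_one_le)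
      then have "2/3 \<le> measure_pmf.prob P {p. good_output G eps n (?PW x) (?PM y) (run p (?PW x) (?PM y))}"
        using P profile_profile_by[of n] unfolding solves_def by blast
      then show ?thesis unfolding good .
    qed
    have "1/36 \<le> 2 ^ C * exp (- real (card I) / 320000)"
    proof (rule randomized_unique_disjointness[where P = P and eA = ?PW and eB = ?PM and Q = Q])
      show "finite I" "I \<noteq> {}" unfolding I_def using k by auto
    next
      fix p x y assume "p \<in> set_pmf P"
      then have "real (comm p (?PW x) (?PM y)) < c * real n ^ 2"
        using cheap profile_profile_by unfolding cost_at_least_def by (meson not_le)
      then show "comm p (?PW x) (?PM y) \<le> C" unfolding C_def by linarith
    next
      fix x y assume "x \<subseteq> I" "x \<inter> y = {}"
      then show "2/3 \<le> measure_pmf.prob P {p. Q (run p (?PW x) (?PM y))}"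
        unfolding Q_def using unique_stable(1)[OF k(3) kn] by (intro prob) (auto simp: I_def)
    next
      fix x y and z :: "nat \<times> nat" assume x: "x \<subseteq> I" and "x \<inter> y = {z}"
      then obtain i j where z: "x \<inter> y = {(i, j)}" "i < k" "j < k"
        unfolding I_def by (cases z) auto
      let ?A = "{p. Q (run p (?PW x) (?PM y))}"
      let ?B = "{p. run p (?PW x) (?PM y) \<subseteq> marriage n (shifted n k i j)
        \<and> eps * real n \<le> real (card (run p (?PW x) (?PM y)))}"
      have B: "2/3 \<le> measure_pmf.prob P ?B"
        using unique_stable(2)[OF k(3) kn _ z(1)] x by (intro prob) (auto simp: I_def)
      \<comment> \<open>An output in both events lies in both marriages, which share at most
        \<open>2 * k\<close> pairs, fewer than \<open>eps * real n\<close>. So the two events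
        compete for probability.\<close>
      have "?A \<inter> ?B = {}"
      proof (rule ccontr)
        assume "?A \<inter> ?B \<noteq> {}"
        then obtain S where S: "S \<subseteq> marriage n (\<lambda>w. w)" "S \<subseteq> marriage n (shifted n k i j)"
          "eps * real n \<le> real (card S)" unfolding Q_def by auto
        have "S \<subseteq> (\<lambda>w. (w, w)) ` {..<2 * k}"
        proof
          fix p assume "p \<in> S"
          then obtain w where w: "p = (w, w)" "w = shifted n k i j w"
            using S(1,2) unfolding marriage_def by blast
          moreover have "shifted n k i j w \<noteq> w" if "2 * k \<le> w"
            using that z(2,3) unfolding shifted_def by auto
          ultimately show "p \<in> (\<lambda>w. (w, w)) ` {..<2 * k}" by fastforce
        qed
        then have "card S \<le> card ((\<lambda>w. (w, w)) ` {..<2 * k})" by (intro card_mono) auto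
        also have "\<dots> \<le> 2 * k" using card_image_le[of "{..<2 * k}"] by simp
        finally have "card S \<le> 2 * k" .
        then show False using S(3) k(1) n(1) by linarith
      qed
      then have "measure_pmf.prob P ?A + measure_pmf.prob P ?B = measure_pmf.prob P (?A \<union> ?B)"
        by (intro measure_pmf.finite_measure_Union[symmetric]) auto
      also have "\<dots> \<le> 1" by (rule measure_pmf.prob_le_1)
      finally show "measure_pmf.prob P ?A \<le> 1/3" using B by linarith
    qed
    \<comment> \<open>With base 2 raised to e, the cost adds c * n^2 to the exponent and the error
      term removes at least twice that; the result is below 1/36.\<close>
    also have "2 ^ C * exp (- real (card I) / 320000) \<le> exp (c * real n ^ 2) * exp (- (2 * (c * real n ^ 2)))"
    proof (rule mult_mono)
      have "(2::real) ^ C \<le> exp 1 ^ C" using exp_ge_add_one_self[of 1] by (intro power_mono) auto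
      also have "\<dots> = exp (real C)" by (simp flip: exp_of_nat_mult)
      also have "\<dots> \<le> exp (c * real n ^ 2)"
        unfolding C_def exp_le_cancel_iff using c by (intro of_nat_floor) simp
      finally show "(2::real) ^ C \<le> exp (c * real n ^ 2)" .
      have "(eps * real n / 8) ^ 2 \<le> real k ^ 2" using k eps by (intro power_mono) auto
      then have "2 * (c * real n ^ 2) \<le> real (card I) / 320000"
        unfolding I_def c_def by (simp add: card_cartesian_product power2_eq_square mult_ac)
      then show "exp (- real (card I) / 320000) \<le> exp (- (2 * (c * real n ^ 2)))" by simp
    qed auto
    also have "\<dots> = inverse (exp (c * real n ^ 2))" by (simp flip: exp_add exp_minus)
    also have "\<dots> \<le> inverse (1 + 36)"
    proof (rule le_imp_inverse_le)
      have "1 \<le> real n" using kn by linarith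
      then have "c * real n * 1 \<le> c * real n * real n" using c by (intro mult_left_mono) auto
      then have "1 + 36 \<le> 1 + c * real n ^ 2" using n(2) by (simp add: power2_eq_square mult.assoc)
      also have "\<dots> \<le> exp (c * real n ^ 2)" by (rule exp_ge_add_one_self)
      finally show "1 + 36 \<le> exp (c * real n ^ 2)" .
    qed simp
    finally show False by simp
  qed
  then show ?thesis using c by blast
qed

theorem theorem12:
  fixes eps :: real
  assumes "0 < eps" and "eps \<le> 1"
  shows "(\<exists>c>0. \<exists>N. \<forall>n\<ge>N. \<forall>P. solves in_some_stable eps n P \<longrightarrow>
              cost_at_least n P (c * real n ^ 2))
       \<and> (\<exists>c>0. \<exists>N. \<forall>n\<ge>N. \<forall>P. solves in_every_stable eps n P \<longrightarrow>
              cost_at_least n P (c * real n ^ 2))"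
proof (intro conjI task_lower_bound[OF assms])
  fix n PW PM \<mu> and p :: "nat \<times> nat"
  assume *: "\<And>\<nu>. stable n PW PM \<nu> \<longleftrightarrow> \<nu> = \<mu>"
  then show "in_some_stable n PW PM p \<longleftrightarrow> p \<in> \<mu>" by (simp add: in_some_stable_def)
  have "stable n PW PM \<mu>" using * by simp
  then have "\<mu> \<subseteq> {..<n} \<times> {..<n}" unfolding stable_def perfect_marriage_def by simp
  then show "in_every_stable n PW PM p \<longleftrightarrow> p \<in> \<mu>" unfolding in_every_stable_def * by auto
qed

end
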